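(* Let $n,k\ge 1$ be natural numbers, let $X$ be a closed subspace of $\mathbb R^k$, and let $f:X\to \exp_n(\mathbb R^k)$ be a continuous map. Then $f$ is fixed-point free if and only if its continuous extension $\tilde f:\beta X\to \exp_n(\beta\mathbb R^k)$ is fixed-point free.
   Context: For a topological space $Z$, $2^Z$ is the space of all non-empty closed subsets of $Z$ with the Vietoris topology, whose basic open sets are $\langle U_1,\dots,U_p\rangle=\{A\in 2^Z: A\subset U_1\cup\dots\cup U_p \text{ and } A\cap U_i\neq\emptyset \text{ for all } i\}$ with $U_1,\dots,U_p$ open in $Z$. $\exp_n(Z)$ is the subspace $\{A\in 2^Z: |A|\le n\}$. $\beta Z$ denotes the Čech–Stone compactification of $Z$. Since $X$ is closed in the normal space $\mathbb R^k$, $\beta X$ is identified with the closure of $X$ in $\beta\mathbb R^k$, so $\beta X\subset\beta\mathbb R^k$. The (unique) continuous extension $\tilde f$ of $f$ exists because $\exp_n(\mathbb R^k)\subset\exp_n(\beta\mathbb R^k)$ and $\exp_n(\beta\mathbb R^k)$ is compact Hausdorff. For $Y\subset Z$, a map $g:Y\to 2^Z$ is fixed-point free if $y\notin g(y)$ for every $y\in Y$. *)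

theory Defs
  imports "HOL-Analysis.Analysis"
begin

section \<open>Hyperspaces\<close>

text \<open>
  In \<open>vietoris_basic Z \<U>\<close> the finite family \<open>U\<^sub>1, \<dots>, U\<^sub>p\<close> of open sets is given as a finite set \<open>\<U>\<close>;
  repetitions and order are irrelevant.  The empty family contributes only the empty basic set.
\<close>

definition vietoris_basic :: "'a topology \<Rightarrow> 'a set set \<Rightarrow> 'a set set" where
  "vietoris_basic Z \<U> =
     {A. closedin Z A \<and> A \<noteq> {} \<and> A \<subseteq> \<Union>\<U> \<and> (\<forall>U\<in>\<U>. A \<inter> U \<noteq> {})}"

definition vietoris :: "'a topology \<Rightarrow> 'a set topology" where
  "vietoris Z = topology_generated_by
     {vietoris_basic Z \<U> |\<U>. finite \<U> \<and> (\<forall>U\<in>\<U>. openin Z U)}"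

definition exp_space :: "nat \<Rightarrow> 'a topology \<Rightarrow> 'a set topology" where
  "exp_space n Z = subtopology (vietoris Z) {A. finite A \<and> card A \<le> n}"

definition fixed_point_free :: "'a set \<Rightarrow> ('a \<Rightarrow> 'a set) \<Rightarrow> bool" where
  "fixed_point_free Y g \<longleftrightarrow> (\<forall>y\<in>Y. y \<notin> g y)"

section \<open>The Cech-Stone compactification\<close>

text \<open>
  The compactification is realised in the standard way: as the closure, in the cube indexed by all
  continuous functions from \<open>Z\<close> to the unit interval, of the image of \<open>Z\<close> under evaluation.  The
  index functions are made \<^const>\<open>undefined\<close> outside the carrier of \<open>Z\<close>, so that each
  continuous function on \<open>Z\<close> occurs exactly once.
\<close>

definition unit_maps :: "'a topology \<Rightarrow> ('a \<Rightarrow> real) set" where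
  "unit_maps Z = {g \<in> extensional (topspace Z). continuous_map Z (top_of_set {0..1}) g}"

definition cech_stone_map :: "'a topology \<Rightarrow> 'a \<Rightarrow> (('a \<Rightarrow> real) \<Rightarrow> real)" where
  "cech_stone_map Z x = (\<lambda>g\<in>unit_maps Z. g x)"

definition unit_cube :: "'a topology \<Rightarrow> (('a \<Rightarrow> real) \<Rightarrow> real) topology" where
  "unit_cube Z = product_topology (\<lambda>_. top_of_set {0..1}) (unit_maps Z)"

definition cech_stone :: "'a topology \<Rightarrow> (('a \<Rightarrow> real) \<Rightarrow> real) topology" where
  "cech_stone Z =
     subtopology (unit_cube Z) (unit_cube Z closure_of (cech_stone_map Z ` topspace Z))"

text \<open>
  For a closed subspace \<open>X\<close> of a normal space \<open>Z\<close>, the compactification of \<open>X\<close> is identified with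
  the closure of \<open>X\<close> in the compactification of \<open>Z\<close>.
\<close>

definition cech_stone_sub :: "'a topology \<Rightarrow> 'a set \<Rightarrow> (('a \<Rightarrow> real) \<Rightarrow> real) topology" where
  "cech_stone_sub Z X =
     subtopology (cech_stone Z) (cech_stone Z closure_of (cech_stone_map Z ` X))"

text \<open>
  The extension of \<open>f\<close> is made \<^const>\<open>undefined\<close> outside its domain, so that it is unique as a
  total function.  A point \<open>x\<close> of \<open>X\<close> is the point \<open>cech_stone_map Z x\<close> of the
  compactification, and a value \<open>f x\<close> is correspondingly replaced by its image.  Existence and
  uniqueness are proved in \<open>cech_stone_ext_ex1\<close> below.
\<close>

definition is_cech_stone_ext ::
  "nat \<Rightarrow> 'a topology \<Rightarrow> 'a set \<Rightarrow> ('a \<Rightarrow> 'a set) \<Rightarrow>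
   ((('a \<Rightarrow> real) \<Rightarrow> real) \<Rightarrow> (('a \<Rightarrow> real) \<Rightarrow> real) set) \<Rightarrow> bool" where
  "is_cech_stone_ext n Z X f g \<longleftrightarrow>
     g \<in> extensional (topspace (cech_stone_sub Z X)) \<and>
     continuous_map (cech_stone_sub Z X) (exp_space n (cech_stone Z)) g \<and>
     (\<forall>x\<in>X. g (cech_stone_map Z x) = cech_stone_map Z ` f x)"

definition cech_stone_ext ::
  "nat \<Rightarrow> 'a topology \<Rightarrow> 'a set \<Rightarrow> ('a \<Rightarrow> 'a set) \<Rightarrow>
   ((('a \<Rightarrow> real) \<Rightarrow> real) \<Rightarrow> (('a \<Rightarrow> real) \<Rightarrow> real) set)" where
  "cech_stone_ext n Z X f = (THE g. is_cech_stone_ext n Z X f g)"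

section \<open>Existence and uniqueness of the extension\<close>

lemma topspace_vietoris: "topspace (vietoris Z) = {A. closedin Z A \<and> A \<noteq> {}}"
proof -
  have "A \<in> vietoris_basic Z {topspace Z}" if "closedin Z A" "A \<noteq> {}" for A
    using that closedin_subset[OF that(1)] by (auto simp: vietoris_basic_def)
  moreover have "finite {topspace Z} \<and> (\<forall>U\<in>{topspace Z}. openin Z U)" by auto
  ultimately have "{A. closedin Z A \<and> A \<noteq> {}} \<subseteq> topspace (vietoris Z)"
    unfolding vietoris_def topology_generated_by_topspace by blast
  then show ?thesis
    unfolding vietoris_def topology_generated_by_topspace by (auto simp: vietoris_basic_def)
qed

lemma topspace_exp_space:
  "topspace (exp_space n Z) = {A. closedin Z A \<and> A \<noteq> {} \<and> finite A \<and> card A \<le> n}"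
  by (auto simp: exp_space_def topspace_vietoris)

lemma openin_vietoris_basic:
  "finite \<U> \<Longrightarrow> (\<And>U. U \<in> \<U> \<Longrightarrow> openin Z U) \<Longrightarrow> openin (vietoris Z) (vietoris_basic Z \<U>)"
  unfolding vietoris_def by (rule topology_generated_by_Basis) blast

lemma openin_exp_space_sub:
  assumes "openin Z U"
  shows "openin (exp_space n Z) {A \<in> topspace (exp_space n Z). A \<subseteq> U}"
proof -
  have "{A \<in> topspace (exp_space n Z). A \<subseteq> U} = vietoris_basic Z {U} \<inter> {A. finite A \<and> card A \<le> n}"
    by (auto simp: topspace_exp_space vietoris_basic_def)
  then show ?thesis
    using openin_vietoris_basic[of "{U}" Z] assms by (auto simp: exp_space_def openin_subtopology)
qed

lemma openin_exp_space_hit: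
  assumes "openin Z U"
  shows "openin (exp_space n Z) {A \<in> topspace (exp_space n Z). A \<inter> U \<noteq> {}}"
proof -
  have "{A \<in> topspace (exp_space n Z). A \<inter> U \<noteq> {}} =
        vietoris_basic Z {U, topspace Z} \<inter> {A. finite A \<and> card A \<le> n}"
    by (auto simp: topspace_exp_space vietoris_basic_def dest: closedin_subset)
  then show ?thesis
    using openin_vietoris_basic[of "{U, topspace Z}" Z] assms
    by (auto simp: exp_space_def openin_subtopology)
qed

lemma continuous_map_exp_spaceI:
  assumes top: "\<And>x. x \<in> topspace T \<Longrightarrow> f x \<in> topspace (exp_space n Z)"
    and sub: "\<And>U. openin Z U \<Longrightarrow> openin T {x \<in> topspace T. f x \<subseteq> U}"
    and hit: "\<And>U. openin Z U \<Longrightarrow> openin T {x \<in> topspace T. f x \<inter> U \<noteq> {}}"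
  shows "continuous_map T (exp_space n Z) f"
  unfolding exp_space_def
proof (rule continuous_map_into_subtopology)
  show "f \<in> topspace T \<rightarrow> {A. finite A \<and> card A \<le> n}"
    using top by (auto simp: topspace_exp_space)
  show "continuous_map T (vietoris Z) f"
    unfolding vietoris_def
  proof (rule continuous_on_generated_topo)
    show "f ` topspace T \<subseteq> \<Union> {vietoris_basic Z \<U> |\<U>. finite \<U> \<and> (\<forall>U\<in>\<U>. openin Z U)}"
      using top topspace_vietoris[of Z, unfolded vietoris_def topology_generated_by_topspace]
      by (auto simp: topspace_exp_space)
    fix W assume "W \<in> {vietoris_basic Z \<U> |\<U>. finite \<U> \<and> (\<forall>U\<in>\<U>. openin Z U)}"
    then obtain \<U> where W: "W = vietoris_basic Z \<U>" and fin: "finite \<U>"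
      and op: "\<And>U. U \<in> \<U> \<Longrightarrow> openin Z U" by auto
    have "f -` W \<inter> topspace T =
          \<Inter> (insert {x \<in> topspace T. f x \<subseteq> \<Union>\<U>} ((\<lambda>U. {x \<in> topspace T. f x \<inter> U \<noteq> {}}) ` \<U>))"
      using top by (auto simp: W vietoris_basic_def topspace_exp_space)
    also have "openin T \<dots>"
      using fin op by (intro openin_Inter) (auto intro!: sub hit)
    finally show "openin T (f -` W \<inter> topspace T)" .
  qed
qed

lemma Hausdorff_exp_space:
  assumes "Hausdorff_space Z"
  shows "Hausdorff_space (exp_space n Z)"
proof -
  have sep: "\<exists>U V. openin (exp_space n Z) U \<and> openin (exp_space n Z) V \<and> A \<in> U \<and> B \<in> V \<and> disjnt U V"
    if A: "A \<in> topspace (exp_space n Z)" and B: "B \<in> topspace (exp_space n Z)"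
      and x: "x \<in> A" "x \<notin> B" for A B x
  proof -
    have "A \<subseteq> topspace Z" "B \<subseteq> topspace Z" "finite B"
      using A B by (auto simp: topspace_exp_space dest: closedin_subset)
    then have "compactin Z {x}" "compactin Z B" "disjnt {x} B"
      using x by (auto simp: finite_imp_compactin)
    then obtain U V where UV: "openin Z U" "openin Z V" "{x} \<subseteq> U" "B \<subseteq> V" "disjnt U V"
      using assms unfolding Hausdorff_space_compact_sets by meson
    show ?thesis
      by (rule exI[of _ "{A \<in> topspace (exp_space n Z). A \<inter> U \<noteq> {}}"],
          rule exI[of _ "{A \<in> topspace (exp_space n Z). A \<subseteq> V}"])
         (use A B x UV in \<open>auto simp: disjnt_def intro!: openin_exp_space_hit openin_exp_space_sub\<close>)
  qed
  show ?thesis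
    unfolding Hausdorff_space_def
  proof (intro allI impI)
    fix A B
    assume *: "A \<in> topspace (exp_space n Z) \<and> B \<in> topspace (exp_space n Z) \<and> A \<noteq> B"
    then consider x where "x \<in> A" "x \<notin> B" | x where "x \<in> B" "x \<notin> A" by auto
    then show "\<exists>U V. openin (exp_space n Z) U \<and> openin (exp_space n Z) V \<and> A \<in> U \<and> B \<in> V \<and> disjnt U V"
    proof cases
      case 1 then show ?thesis using sep * by blast
    next
      case 2
      then obtain U V where "openin (exp_space n Z) U" "openin (exp_space n Z) V" "B \<in> U" "A \<in> V" "disjnt U V"
        using sep[of B A] * by blast
      then show ?thesis using disjnt_sym by blast
    qed
  qed
qed

lemma compact_exp_space:
  assumes "Hausdorff_space Z" "compact_space Z"
  shows "compact_space (exp_space n Z)"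
proof -
  let ?P = "product_topology (\<lambda>_. Z) {..<n}"
  let ?\<phi> = "\<lambda>x. x ` {..<n}"
  show ?thesis
  proof (cases "n = 0")
    case True
    then have "topspace (exp_space n Z) = {}" by (auto simp: topspace_exp_space)
    then show ?thesis by (simp add: compact_space_def)
  next
    case False
    have co: "continuous_map ?P Z (\<lambda>x. x i)" if "i < n" for i
      by (rule continuous_map_product_projection) (use that in auto)
    have "continuous_map ?P (exp_space n Z) ?\<phi>"
    proof (rule continuous_map_exp_spaceI)
      fix x assume x: "x \<in> topspace ?P"
      then have "x ` {..<n} \<subseteq> topspace Z" by (auto simp: PiE_iff)
      moreover have "closedin Z (x ` {..<n})"
        using calculation assms(1) finite_imp_compactin compactin_imp_closedin by blast
      moreover have "card (x ` {..<n}) \<le> n" using card_image_le[of "{..<n}" x] by simp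
      ultimately show "x ` {..<n} \<in> topspace (exp_space n Z)"
        using False by (auto simp: topspace_exp_space)
    next
      fix U assume U: "openin Z U"
      have op: "openin ?P {x \<in> topspace ?P. x i \<in> U}" if "i < n" for i
        by (rule openin_continuous_map_preimage[OF co[OF that] U])
      have "{x \<in> topspace ?P. ?\<phi> x \<subseteq> U} = \<Inter> ((\<lambda>i. {x \<in> topspace ?P. x i \<in> U}) ` {..<n})"
        using False by auto
      also have "openin ?P \<dots>"
        by (intro openin_Inter) (use False op in auto)
      finally show "openin ?P {x \<in> topspace ?P. ?\<phi> x \<subseteq> U}" .
      have "{x \<in> topspace ?P. ?\<phi> x \<inter> U \<noteq> {}} = \<Union> ((\<lambda>i. {x \<in> topspace ?P. x i \<in> U}) ` {..<n})"
        by auto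
      also have "openin ?P \<dots>"
        by (intro openin_Union) (use op in auto)
      finally show "openin ?P {x \<in> topspace ?P. ?\<phi> x \<inter> U \<noteq> {}}" .
    qed
    moreover have "topspace (exp_space n Z) \<subseteq> ?\<phi> ` topspace ?P"
    proof
      fix A assume "A \<in> topspace (exp_space n Z)"
      then have A: "A \<noteq> {}" "finite A" "card A \<le> n" "A \<subseteq> topspace Z"
        by (auto simp: topspace_exp_space dest: closedin_subset)
      then have "card A \<le> card {..<n}" by simp
      then obtain h where h: "h ` A \<subseteq> {..<n}" "inj_on h A"
        using card_le_inj[of A "{..<n}"] A by auto
      obtain a where a: "a \<in> A" using A by auto
      define x where "x = (\<lambda>i\<in>{..<n}. if i \<in> h ` A then inv_into A h i else a)"
      have xA: "x i \<in> A" if "i < n" for i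
        using that a by (auto simp: x_def inv_into_into)
      moreover have "y \<in> x ` {..<n}" if "y \<in> A" for y
        by (rule image_eqI[of _ _ "h y"]) (use that h in \<open>auto simp: x_def\<close>)
      ultimately have "?\<phi> x = A" by auto
      moreover have "x \<in> topspace ?P"
      proof -
        have "x \<in> extensional {..<n}" by (simp add: x_def)
        then show ?thesis using xA A(4) by (auto simp: PiE_iff)
      qed
      ultimately show "A \<in> ?\<phi> ` topspace ?P" by blast
    qed
    moreover have "compactin ?P (topspace ?P)"
      using assms compact_space_product_topology[of "\<lambda>_. Z" "{..<n}"] by (simp add: compact_space_def)
    ultimately show ?thesis
      unfolding compact_space_def
      by (metis continuous_map_image_subset_topspace image_compactin subset_antisym)
  qed
qed

lemma unit_cube_compact_Hausdorff: "compact_space (unit_cube Z)" "Hausdorff_space (unit_cube Z)"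
  by (auto simp: unit_cube_def compact_space_product_topology Hausdorff_space_product_topology
      compact_space_subtopology Hausdorff_space_subtopology)

lemma cech_stone_compact_Hausdorff: "compact_space (cech_stone Z)" "Hausdorff_space (cech_stone Z)"
  using unit_cube_compact_Hausdorff[of Z]
  by (auto simp: cech_stone_def Hausdorff_space_subtopology closedin_compact_space compact_space_subtopology)

lemma continuous_map_cech_stone_map: "continuous_map Z (cech_stone Z) (cech_stone_map Z)"
proof -
  have "continuous_map Z (unit_cube Z) (cech_stone_map Z)"
    unfolding unit_cube_def
    by (subst continuous_map_componentwise) (auto simp: cech_stone_map_def unit_maps_def)
  then show ?thesis
    unfolding cech_stone_def
    by (intro continuous_map_into_subtopology)
       (auto dest!: continuous_map_image_subset_topspace closure_of_subset)
qed

lemma continuous_map_cech_stone_coord: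
  assumes "c \<in> unit_maps Z"
  shows "continuous_map (cech_stone Z) (top_of_set {0..1}) (\<lambda>p. p c)"
  unfolding cech_stone_def unit_cube_def
  by (rule continuous_map_from_subtopology[OF continuous_map_product_projection[OF assms]])

lemma topspace_cech_stone_sub:
  "topspace (cech_stone_sub Z X) = cech_stone Z closure_of (cech_stone_map Z ` X)"
  by (simp add: cech_stone_sub_def Int_absorb1 closure_of_subset_topspace)

lemma cech_stone_map_in_sub:
  assumes "X \<subseteq> topspace Z" "x \<in> X"
  shows "cech_stone_map Z x \<in> topspace (cech_stone_sub Z X)"
proof -
  have "cech_stone_map Z ` X \<subseteq> topspace (cech_stone Z)"
    using assms continuous_map_image_subset_topspace[OF continuous_map_cech_stone_map[of Z]] by blast
  then show ?thesis using closure_of_subset assms unfolding topspace_cech_stone_sub by blast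
qed

text \<open>
  The closure of \<open>X\<close> has the universal property of the compactification of \<open>X\<close>, so the
  identification made above is legitimate.
\<close>

lemma cech_stone_sub_extend:
  fixes K :: "'b topology"
  assumes Z: "normal_space Z" and X: "closedin Z X"
    and K: "compact_space K" "Hausdorff_space K"
    and h: "continuous_map (subtopology Z X) K h"
  obtains g where "continuous_map (cech_stone_sub Z X) K g"
    "\<And>x. x \<in> X \<Longrightarrow> g (cech_stone_map Z x) = h x"
proof -
  have Xs: "X \<subseteq> topspace Z" using X closedin_subset by blast
  have "completely_regular_space K"
    using K compact_Hausdorff_or_regular_imp_normal_space normal_imp_completely_regular_space by blast
  then obtain I :: "('b \<Rightarrow> real) set" and \<iota>
    where emb: "embedding_map K (product_topology (\<lambda>f. top_of_set {0..1::real}) I) \<iota>"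
    using completely_regular_space_cube_embedding_explicit[OF _ K(2)] by fast
  let ?C = "product_topology (\<lambda>f::'b\<Rightarrow>real. top_of_set {0..1::real}) I"
  have hom: "homeomorphic_map K (subtopology ?C (\<iota> ` topspace K)) \<iota>"
    using emb by (simp add: embedding_map_def)
  have \<iota>c: "continuous_map K ?C \<iota>"
    using emb embedding_map_def homeomorphic_imp_continuous_map continuous_map_in_subtopology by blast
  obtain \<kappa> where \<kappa>: "homeomorphic_maps K (subtopology ?C (\<iota> ` topspace K)) \<iota> \<kappa>"
    using hom homeomorphic_map_maps by blast
  have HC: "Hausdorff_space ?C"
    by (auto simp: Hausdorff_space_product_topology Hausdorff_space_subtopology)
  have clo: "closedin ?C (\<iota> ` topspace K)"
    using image_compactin[of K "topspace K" ?C \<iota>] K(1) \<iota>c HC compactin_imp_closedin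
    by (auto simp: compact_space_def)
  have "\<exists>c. c \<in> unit_maps Z \<and> (\<forall>x\<in>X. c x = \<iota> (h x) i)" if i: "i \<in> I" for i
  proof -
    have c1: "continuous_map (subtopology Z X) (top_of_set {0..1}) (\<lambda>x. \<iota> (h x) i)"
      using continuous_map_compose[OF continuous_map_compose[OF h \<iota>c]
          continuous_map_product_projection[OF i]] by (simp add: o_def)
    have c2: "continuous_map (subtopology Z X) euclideanreal (\<lambda>x. \<iota> (h x) i)"
      using c1 continuous_map_in_subtopology by blast
    have c3: "(\<lambda>x. \<iota> (h x) i) ` X \<subseteq> {0..1}"
      using continuous_map_image_subset_topspace[OF c1] Xs by (auto simp: Int_absorb1)
    obtain g where g: "continuous_map Z euclideanreal g" "\<And>x. x \<in> X \<Longrightarrow> g x = \<iota> (h x) i"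
        "g ` topspace Z \<subseteq> {0..1}"
      using Tietze_extension_closed_real_interval[OF Z X c2 c3] by auto
    have "continuous_map Z (top_of_set {0..1}) g"
      using g by (auto simp: continuous_map_in_subtopology)
    then have "continuous_map Z (top_of_set {0..1}) (restrict g (topspace Z))"
      using continuous_map_eq by fastforce
    then have "restrict g (topspace Z) \<in> unit_maps Z" by (auto simp: unit_maps_def)
    then show ?thesis using g(2) Xs by (intro exI[of _ "restrict g (topspace Z)"]) auto
  qed
  then obtain c where c: "\<And>i. i \<in> I \<Longrightarrow> c i \<in> unit_maps Z"
    and ch: "\<And>i x. i \<in> I \<Longrightarrow> x \<in> X \<Longrightarrow> c i x = \<iota> (h x) i" by metis
  define F where "F = (\<lambda>p. \<lambda>i\<in>I. p (c i) :: real)"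
  have F: "continuous_map (cech_stone Z) ?C F"
    unfolding continuous_map_componentwise
    using continuous_map_cech_stone_coord c by (auto simp: F_def)
  have Fe: "F (cech_stone_map Z x) = \<iota> (h x)" and hK: "h x \<in> topspace K" if "x \<in> X" for x
  proof -
    show "h x \<in> topspace K"
      using continuous_map_image_subset_topspace[OF h] that Xs by auto
    then have "\<iota> (h x) \<in> topspace ?C"
      using continuous_map_image_subset_topspace[OF \<iota>c] by blast
    then show "F (cech_stone_map Z x) = \<iota> (h x)"
      using that c ch by (auto simp: F_def cech_stone_map_def fun_eq_iff PiE_iff extensional_def)
  qed
  have "F ` (cech_stone Z closure_of (cech_stone_map Z ` X)) \<subseteq> ?C closure_of (F ` cech_stone_map Z ` X)"
    using F continuous_map_image_closure_subset by blast
  also have "\<dots> \<subseteq> \<iota> ` topspace K"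
    by (rule closure_of_minimal[OF _ clo]) (use Fe hK in auto)
  finally have "continuous_map (cech_stone_sub Z X) (subtopology ?C (\<iota> ` topspace K)) F"
    unfolding cech_stone_sub_def
    using F by (auto simp: continuous_map_in_subtopology image_subset_iff
        intro: continuous_map_from_subtopology)
  then have "continuous_map (cech_stone_sub Z X) K (\<kappa> \<circ> F)"
    using \<kappa> by (auto simp: homeomorphic_maps_def intro: continuous_map_compose)
  moreover have "(\<kappa> \<circ> F) (cech_stone_map Z x) = h x" if "x \<in> X" for x
    using Fe[OF that] hK[OF that] \<kappa> by (auto simp: homeomorphic_maps_def)
  ultimately show thesis using that by blast
qed

lemma cech_stone_ext_ex1:
  fixes Z :: "'a topology"
  assumes Z: "normal_space Z" and X: "closedin Z X"
    and f: "continuous_map (subtopology Z X) (exp_space n Z) f"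
  shows "\<exists>!g. is_cech_stone_ext n Z X f g"
proof -
  let ?e = "cech_stone_map Z" and ?B = "cech_stone Z"
  let ?E = "exp_space n ?B"
  have Xs: "X \<subseteq> topspace Z" using X closedin_subset by blast
  have tX: "topspace (subtopology Z X) = X" using Xs by auto
  have KE: "compact_space ?E" "Hausdorff_space ?E"
    using compact_exp_space Hausdorff_exp_space cech_stone_compact_Hausdorff by blast+
  have fx: "f x \<in> topspace (exp_space n Z)" if "x \<in> X" for x
    using continuous_map_image_subset_topspace[OF f] that tX by blast
  have "continuous_map (subtopology Z X) ?E (\<lambda>x. ?e ` f x)"
  proof (rule continuous_map_exp_spaceI)
    fix x assume "x \<in> topspace (subtopology Z X)"
    then have "f x \<in> topspace (exp_space n Z)" using fx tX by blast
    then have fin: "finite (f x)" "f x \<noteq> {}" "card (f x) \<le> n" "f x \<subseteq> topspace Z"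
      by (auto simp: topspace_exp_space dest: closedin_subset)
    then have "?e ` f x \<subseteq> topspace ?B"
      using continuous_map_image_subset_topspace[OF continuous_map_cech_stone_map[of Z]] by blast
    then have "closedin ?B (?e ` f x)"
      using fin cech_stone_compact_Hausdorff(2) finite_imp_compactin compactin_imp_closedin by blast
    then show "?e ` f x \<in> topspace ?E"
      using fin card_image_le[OF fin(1), of ?e] by (auto simp: topspace_exp_space)
  next
    fix U assume U: "openin ?B U"
    let ?V = "{z \<in> topspace Z. ?e z \<in> U}"
    have V: "openin Z ?V"
      by (rule openin_continuous_map_preimage[OF continuous_map_cech_stone_map U])
    have fZ: "f x \<subseteq> topspace Z" if "x \<in> X" for x
      using fx[OF that] by (auto simp: topspace_exp_space dest: closedin_subset)
    have "{x \<in> topspace (subtopology Z X). ?e ` f x \<subseteq> U} =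
      {x \<in> topspace (subtopology Z X). f x \<in> {A \<in> topspace (exp_space n Z). A \<subseteq> ?V}}"
      using fx fZ unfolding tX by blast
    then show "openin (subtopology Z X) {x \<in> topspace (subtopology Z X). ?e ` f x \<subseteq> U}"
      using openin_continuous_map_preimage[OF f openin_exp_space_sub[OF V]] by simp
    have "{x \<in> topspace (subtopology Z X). ?e ` f x \<inter> U \<noteq> {}} =
      {x \<in> topspace (subtopology Z X). f x \<in> {A \<in> topspace (exp_space n Z). A \<inter> ?V \<noteq> {}}}"
      using fx fZ unfolding tX by blast
    then show "openin (subtopology Z X) {x \<in> topspace (subtopology Z X). ?e ` f x \<inter> U \<noteq> {}}"
      using openin_continuous_map_preimage[OF f openin_exp_space_hit[OF V]] by simp
  qed
  then obtain g where g: "continuous_map (cech_stone_sub Z X) ?E g"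
    "\<And>x. x \<in> X \<Longrightarrow> g (?e x) = ?e ` f x"
    using cech_stone_sub_extend[OF Z X KE] by metis
  let ?T = "topspace (cech_stone_sub Z X)"
  have "is_cech_stone_ext n Z X f (restrict g ?T)"
    unfolding is_cech_stone_ext_def
    using g cech_stone_map_in_sub[OF Xs] continuous_map_eq[OF g(1), of "restrict g ?T"] by auto
  moreover have "g1 = g2"
    if g1: "is_cech_stone_ext n Z X f g1" and g2: "is_cech_stone_ext n Z X f g2" for g1 g2
  proof (rule extensionalityI)
    show "g1 \<in> extensional ?T" "g2 \<in> extensional ?T"
      using g1 g2 by (auto simp: is_cech_stone_ext_def)
    fix p assume p: "p \<in> ?T"
    have "?T = cech_stone_sub Z X closure_of (?e ` X)"
    proof -
      have "?e ` X \<subseteq> ?B closure_of (?e ` X)"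
        using cech_stone_map_in_sub[OF Xs] by (auto simp: topspace_cech_stone_sub)
      then show ?thesis
        unfolding topspace_cech_stone_sub
        by (simp add: cech_stone_sub_def closure_of_subtopology Int_absorb1)
    qed
    with p have "p \<in> cech_stone_sub Z X closure_of (?e ` X)" by simp
    then show "g1 p = g2 p"
      by (rule forall_in_closure_of_eq[OF _ KE(2)])
         (use g1 g2 in \<open>auto simp: is_cech_stone_ext_def\<close>)
  qed
  ultimately show ?thesis by blast
qed

end

theory Submission
  imports Defs
begin

text \<open>
  It suffices to find finitely many continuous functions from the whole space to the unit interval
  which separate, with a uniform gap, every point \<open>x\<close> of \<open>X\<close> from every point of \<open>f x\<close>: they extend
  to the compactification, and by density they separate \<open>p\<close> from every point of the extended value
  at \<open>p\<close>.

  Covering dimension enters only through grids of small cubes: cubes whose integer coordinates have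
  the same parities are pairwise disjoint, so there are \<open>2\<^sup>k\<close> classes of disjoint cells.  Cutting
  \<open>X\<close> into concentric annuli, each carried by \<open>f\<close> into the union of the annuli up to the next one,
  and then cutting each annulus into small cells \<open>E\<close> with \<open>f\<close> free of \<open>E\<close> on \<open>E\<close>, one is left
  with pairs \<open>(x, y)\<close>, \<open>y \<in> f x\<close>, lying in distinct cells of one class.  Orient such a pair by an
  enumeration of the cells, level by level, or by the one with the order reversed inside each level;
  since distinct levels of equal parity are at least two apart, \<open>y\<close> precedes \<open>x\<close> in one of the two.  Pairs
  with \<open>y\<close> before \<open>x\<close> are separated by colouring the cells recursively: \<open>f x\<close> has at most \<open>n\<close>
  points, so near each \<open>x\<close> one of \<open>n + 1\<close> colours is not yet used on \<open>f x\<close>.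
\<close>

section \<open>Finitely separated sets of pairs\<close>

text \<open>Equivalently, the image of \<open>\<Gamma>\<close> in the square of the Cech-Stone
  compactification has closure disjoint from the diagonal.\<close>

definition finitely_separated :: "('a::topological_space \<times> 'a) set \<Rightarrow> bool" where
  "finitely_separated \<Gamma> \<longleftrightarrow>
     (\<exists>C \<epsilon>. finite C \<and> 0 < \<epsilon> \<and>
        (\<forall>c\<in>C. continuous_on UNIV c \<and> range c \<subseteq> {0..1::real}) \<and>
        (\<forall>x y. (x, y) \<in> \<Gamma> \<longrightarrow> (\<exists>c\<in>C. \<epsilon> \<le> \<bar>c x - c y\<bar>)))"

lemma finitely_separatedI:
  assumes "finite C" "0 < \<epsilon>"
    and "\<And>c. c \<in> C \<Longrightarrow> continuous_on UNIV c" "\<And>c x. c \<in> C \<Longrightarrow> c x \<in> {0..1::real}"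
    and "\<And>x y. (x, y) \<in> \<Gamma> \<Longrightarrow> \<exists>c\<in>C. \<epsilon> \<le> \<bar>c x - c y\<bar>"
  shows "finitely_separated \<Gamma>"
  using assms unfolding finitely_separated_def
  by (intro exI[of _ C] exI[of _ \<epsilon>]) auto

lemma finitely_separatedE:
  assumes "finitely_separated \<Gamma>"
  obtains C \<epsilon> where "finite C" "0 < \<epsilon>"
    "\<And>c. c \<in> C \<Longrightarrow> continuous_on UNIV c" "\<And>c x. c \<in> C \<Longrightarrow> c x \<in> {0..1::real}"
    "\<And>x y. (x, y) \<in> \<Gamma> \<Longrightarrow> \<exists>c\<in>C. \<epsilon> \<le> \<bar>c x - c y\<bar>"
  using assms unfolding finitely_separated_def image_subset_iff by blast

lemma finitely_separated_subset:
  "finitely_separated \<Delta> \<Longrightarrow> \<Gamma> \<subseteq> \<Delta> \<Longrightarrow> finitely_separated \<Gamma>"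
  by (erule finitely_separatedE, rule finitely_separatedI) blast+

lemma finitely_separated_empty [simp]: "finitely_separated {}"
  by (rule finitely_separatedI[of "{}" 1]) auto

lemma finitely_separated_Un:
  assumes "finitely_separated \<Gamma>" "finitely_separated \<Delta>"
  shows "finitely_separated (\<Gamma> \<union> \<Delta>)"
proof -
  obtain C \<epsilon> where C: "finite C" "0 < \<epsilon>"
    "\<And>c. c \<in> C \<Longrightarrow> continuous_on UNIV c" "\<And>c x. c \<in> C \<Longrightarrow> c x \<in> {0..1::real}"
    "\<And>x y. (x, y) \<in> \<Gamma> \<Longrightarrow> \<exists>c\<in>C. \<epsilon> \<le> \<bar>c x - c y\<bar>"
    using assms(1) by (rule finitely_separatedE) blast
  obtain D \<delta> where D: "finite D" "0 < \<delta>"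
    "\<And>c. c \<in> D \<Longrightarrow> continuous_on UNIV c" "\<And>c x. c \<in> D \<Longrightarrow> c x \<in> {0..1::real}"
    "\<And>x y. (x, y) \<in> \<Delta> \<Longrightarrow> \<exists>c\<in>D. \<delta> \<le> \<bar>c x - c y\<bar>"
    using assms(2) by (rule finitely_separatedE) blast
  show ?thesis
  proof (rule finitely_separatedI[of "C \<union> D" "min \<epsilon> \<delta>"])
    show "\<exists>c\<in>C \<union> D. min \<epsilon> \<delta> \<le> \<bar>c x - c y\<bar>" if "(x, y) \<in> \<Gamma> \<union> \<Delta>" for x y
    proof (cases "(x, y) \<in> \<Gamma>")
      case True
      with C(5) obtain c where "c \<in> C" "\<epsilon> \<le> \<bar>c x - c y\<bar>" by blast
      then show ?thesis by (intro bexI[of _ c]) auto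
    next
      case False
      with that D(5) obtain c where "c \<in> D" "\<delta> \<le> \<bar>c x - c y\<bar>" by blast
      then show ?thesis by (intro bexI[of _ c]) auto
    qed
    show "c x \<in> {0..1}" if "c \<in> C \<union> D" for c x
      using that C(4) D(4) by blast
  qed (use C D in auto)
qed

lemma finitely_separated_UN:
  "finite I \<Longrightarrow> (\<And>i. i \<in> I \<Longrightarrow> finitely_separated (\<Gamma> i)) \<Longrightarrow> finitely_separated (\<Union>i\<in>I. \<Gamma> i)"
  by (induction I rule: finite_induct) (auto intro: finitely_separated_Un)

text \<open>Serves for the pairs whose second point leaves a neighbourhood of the cells; a Urysohn
  function separates them with gap 1.\<close>

lemma finitely_separated_closed_Times:
  fixes S T :: "'a::euclidean_space set"
  assumes "closed S" "closed T" "S \<inter> T = {}"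
  shows "finitely_separated (S \<times> T)"
proof -
  obtain c :: "'a \<Rightarrow> real" where c: "continuous_on UNIV c" "\<And>x. c x \<in> closed_segment 0 1"
      "\<And>x. x \<in> S \<Longrightarrow> c x = 0" "\<And>x. x \<in> T \<Longrightarrow> c x = 1"
    using Urysohn_local[of UNIV S T 0 "1::real"] assms by auto
  show ?thesis
    by (rule finitely_separatedI[of "{c}" 1]) (use c in \<open>auto simp: closed_segment_eq_real_ivl\<close>)
qed

section \<open>Locally finite families of closed sets\<close>

text \<open>Balls about the origin suffice to test local finiteness: the one of radius
  \<open>norm x + 1\<close> is a neighbourhood of \<open>x\<close>.\<close>

lemma closed_UN_locally_finite:
  fixes E :: "'i \<Rightarrow> 'a::real_normed_vector set"
  assumes clo: "\<And>i. i \<in> I \<Longrightarrow> closed (E i)"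
    and fin: "\<And>R. finite {i \<in> I. E i \<inter> ball 0 R \<noteq> {}}"
  shows "closed (\<Union>i\<in>I. E i)"
proof -
  have "locally_finite_in euclidean (E ` I)"
    unfolding locally_finite_in_def
  proof (intro conjI ballI)
    fix x :: 'a
    have "{U \<in> E ` I. U \<inter> ball 0 (norm x + 1) \<noteq> {}} = E ` {i \<in> I. E i \<inter> ball 0 (norm x + 1) \<noteq> {}}"
      by auto
    then show "\<exists>V. openin euclidean V \<and> x \<in> V \<and> finite {U \<in> E ` I. U \<inter> V \<noteq> {}}"
      using fin by (intro exI[of _ "ball 0 (norm x + 1)"]) auto
  qed auto
  then have "closedin euclidean (\<Union> (E ` I))"
    by (rule closedin_locally_finite_Union[rotated]) (use clo in auto)
  then show ?thesis by simp
qed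

text \<open>Disjointness makes the local functions agree on overlaps, so locally finite pasting
  gives a continuous function on the closed union; Tietze's theorem extends it with values still in
  the unit interval.\<close>

lemma paste_locally_finite_disjoint:
  fixes E :: "'i \<Rightarrow> 'a::euclidean_space set" and \<phi> :: "'i \<Rightarrow> 'a \<Rightarrow> real"
  assumes clo: "\<And>i. closed (E i)"
    and fin: "\<And>R. finite {i. E i \<inter> ball 0 R \<noteq> {}}"
    and disj: "\<And>i j. i \<noteq> j \<Longrightarrow> E i \<inter> E j = {}"
    and cont: "\<And>i. continuous_on UNIV (\<phi> i)"
    and ran: "\<And>i x. \<phi> i x \<in> {0..1}"
  obtains \<Phi> where "continuous_on UNIV \<Phi>" "\<And>x. \<Phi> x \<in> {0..1}" "\<And>i x. x \<in> E i \<Longrightarrow> \<Phi> x = \<phi> i x"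
proof -
  let ?U = "\<Union>i. E i"
  have clU: "closed ?U"
    using closed_UN_locally_finite[of UNIV E] clo fin by simp
  have locfin: "\<exists>V. openin (top_of_set ?U) V \<and> x \<in> V \<and> finite {i \<in> UNIV. E i \<inter> V \<noteq> {}}"
    if x: "x \<in> topspace (top_of_set ?U)" for x
  proof -
    let ?V = "?U \<inter> ball 0 (norm x + 1)"
    have "{i \<in> UNIV. E i \<inter> ?V \<noteq> {}} = {i. E i \<inter> ball 0 (norm x + 1) \<noteq> {}}" by blast
    then have "finite {i \<in> UNIV. E i \<inter> ?V \<noteq> {}}" using fin by simp
    moreover have "openin (top_of_set ?U) ?V" by (simp add: openin_open_Int)
    ultimately show ?thesis using x by (intro exI[of _ ?V]) auto
  qed
  have clE: "closedin (top_of_set ?U) (E i)" for i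
    by (rule closed_subset) (use clo in auto)
  have contE: "continuous_map (subtopology (top_of_set ?U) (E i)) euclideanreal (\<phi> i)" for i
    using continuous_on_subset[OF cont[of i]] by (simp add: subtopology_subtopology)
  have agree: "\<phi> i x = \<phi> j x" if "x \<in> topspace (top_of_set ?U) \<inter> E i \<inter> E j" for i j x
    using that disj[of i j] by (cases "i = j") auto
  define g where "g x = \<phi> (SOME i. x \<in> E i) x" for x
  have g': "g x = \<phi> i x" if "x \<in> E i" for i x
  proof -
    have "x \<in> E (SOME i. x \<in> E i)" using that by (rule someI)
    then have "(SOME i. x \<in> E i) = i" using that disj by blast
    then show ?thesis by (simp add: g_def)
  qed
  have g: "continuous_map (top_of_set ?U) euclideanreal g"
    by (rule pasting_lemma_locally_finite[OF locfin clE contE agree]) (use g' in auto)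
  have gU: "g ` ?U \<subseteq> {0..1}"
    using g' ran by fastforce
  obtain \<Phi> where \<Phi>: "continuous_map euclidean euclideanreal \<Phi>"
      "\<And>x. x \<in> ?U \<Longrightarrow> \<Phi> x = g x" "\<Phi> ` topspace euclidean \<subseteq> {0..1}"
    by (rule Tietze_extension_closed_real_interval[OF
          metrizable_imp_normal_space[OF metrizable_space_euclidean] _ g, of 0 1]) (use clU gU in auto)
  show thesis
  proof (rule that[of \<Phi>])
    show "\<Phi> x = \<phi> i x" if "x \<in> E i" for i x
      using \<Phi>(2)[of x] g'[OF that] that by auto
  qed (use \<Phi> in \<open>auto simp: image_subset_iff\<close>)
qed

section \<open>Disjoint cells from grid cubes\<close>

text \<open>Here \<open>b\<close> ranges over the parity patterns of cube indices. Below a Lebesgue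
  number of a common refinement, each slightly enlarged cube fits into a member of the cover
  belonging to its own pattern, so the covers may differ from class to class. \<open>P\<close>,
  \<open>V\<close> and \<open>E\<close> are unions of cubes, of open and of closed enlarged cubes;
  the cores \<open>P\<close> of a single class need not cover \<open>K\<close>.\<close>

lemma parity_class_cells:
  fixes K :: "(real^'k) set" and W :: "'k set \<Rightarrow> 'u \<Rightarrow> (real^'k) set"
  assumes K: "compact K" and W: "\<And>b u. open (W b u)" and cover: "\<And>b. K \<subseteq> (\<Union>u. W b u)"
  obtains P V E where "\<And>b u. compact (P b u)" "\<And>b u. open (V b u)" "\<And>b u. compact (E b u)"
    "\<And>b u. P b u \<subseteq> V b u" "\<And>b u. V b u \<subseteq> E b u" "\<And>b u. E b u \<subseteq> W b u"
    "\<And>b u v. u \<noteq> v \<Longrightarrow> E b u \<inter> E b v = {}" "K \<subseteq> (\<Union>b. \<Union>u. P b u)"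
proof -
  \<comment> \<open>A common refinement of the covers of all classes; its members are open because
    there are finitely many classes \<open>b\<close>.\<close>
  let ?\<G> = "range (\<lambda>h. \<Inter>b. W b (h b))"
  have "\<exists>h. x \<in> (\<Inter>b. W b (h b))" if "x \<in> K" for x
  proof -
    have "\<forall>b. \<exists>u. x \<in> W b u" using cover that by blast
    then show ?thesis by (simp add: choice_iff)
  qed
  then have "K \<subseteq> \<Union>?\<G>" by auto
  moreover have "open G" if "G \<in> ?\<G>" for G
    using that W by auto
  ultimately obtain e where e: "0 < e" "\<And>x. x \<in> K \<Longrightarrow> \<exists>G\<in>?\<G>. ball x e \<subseteq> G"
    using Heine_Borel_lemma[OF K, of ?\<G>] by blast
  \<comment> \<open>An enlarged cube has sides \<open>3/2 * s\<close>, so the l1 bound on the norm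
    gives diameter at most \<open>3/4 * e\<close>.\<close>
  define s where "s = e / (2 * CARD('k))"
  have s: "0 < s" using e by (simp add: s_def)
  \<comment> \<open>Corners of the cube with index \<open>z\<close> in the grid of mesh
    \<open>s\<close>, pushed outwards by \<open>t * s\<close>; \<open>t\<close> will be 0 or
    1/4.\<close>
  define lo hi :: "real \<Rightarrow> ('k \<Rightarrow> int) \<Rightarrow> real^'k"
    where "lo t z = (\<chi> i. (z i - t) * s)" and "hi t z = (\<chi> i. (z i + 1 + t) * s)" for t z
  define par where "par z = {i. even (z i)}" for z :: "'k \<Rightarrow> int"
  define Z where "Z = {z. cbox (lo 0 z) (hi 0 z) \<inter> K \<noteq> {}}"
  have "finite Z"
  proof -
    obtain B where B: "\<And>x. x \<in> K \<Longrightarrow> norm x \<le> B"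
      using compact_imp_bounded[OF K] by (auto simp: bounded_iff)
    let ?S = "{- \<lceil>B / s\<rceil> - 1..\<lceil>B / s\<rceil>}"
    have "z i \<in> ?S" if z: "z \<in> Z" for z i
    proof -
      obtain x where x: "x \<in> K" "x \<in> cbox (lo 0 z) (hi 0 z)" using z by (auto simp: Z_def)
      have "\<bar>x $ i\<bar> \<le> B" using component_le_norm_cart[of x i] B[OF x(1)] by linarith
      moreover have "z i * s \<le> x $ i" "x $ i \<le> (z i + 1) * s"
        using x(2) by (auto simp: mem_box_cart lo_def hi_def)
      ultimately have "z i * s \<le> B" "- B \<le> (z i + 1) * s" by linarith+
      then have "z i \<le> B / s" "- (z i + 1) \<le> B / s"
        using s by (auto simp: field_simps)
      then show ?thesis
        using le_of_int_ceiling[of "B / s"] by simp linarith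
    qed
    then have "Z \<subseteq> PiE UNIV (\<lambda>_. ?S)" by auto
    moreover have "finite (PiE (UNIV::'k set) (\<lambda>_. ?S))" by (intro finite_PiE) auto
    ultimately show ?thesis by (rule finite_subset)
  qed
  have diam: "dist x y < e" if "x \<in> cbox (lo (1/4) z) (hi (1/4) z)" "y \<in> cbox (lo (1/4) z) (hi (1/4) z)" for x y z
  proof -
    have "\<bar>(x - y) $ i\<bar> \<le> 3/2 * s" for i
    proof -
      have "(z i - 1/4) * s \<le> x $ i" "x $ i \<le> (z i + 1 + 1/4) * s"
        "(z i - 1/4) * s \<le> y $ i" "y $ i \<le> (z i + 1 + 1/4) * s"
        using that by (auto simp: mem_box_cart lo_def hi_def)
      then show ?thesis
        unfolding vector_minus_component left_diff_distrib distrib_right of_int_add of_int_1 by linarith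
    qed
    then have "(\<Sum>i\<in>UNIV. \<bar>(x - y) $ i\<bar>) \<le> (\<Sum>i\<in>(UNIV::'k set). 3/2 * s)"
      by (rule sum_mono)
    with norm_le_l1_cart have "norm (x - y) \<le> (\<Sum>i\<in>(UNIV::'k set). 3/2 * s)"
      by (rule order_trans)
    also have "\<dots> < e" using e by (simp add: s_def field_simps)
    finally show ?thesis by (simp add: dist_norm)
  qed
  have grow: "cbox (lo 0 z) (hi 0 z) \<subseteq> box (lo (1/4) z) (hi (1/4) z)" for z
  proof
    fix x assume x: "x \<in> cbox (lo 0 z) (hi 0 z)"
    have "(z i - 1/4) * s < x $ i \<and> x $ i < (z i + 1 + 1/4) * s" for i
    proof -
      have "z i * s \<le> x $ i" "x $ i \<le> (z i + 1) * s"
        using x by (auto simp: mem_box_cart lo_def hi_def)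
      moreover have "(z i - 1/4) * s < z i * s" "(z i + 1) * s < (z i + 1 + 1/4) * s"
        using s by (auto simp: algebra_simps)
      ultimately show ?thesis by linarith
    qed
    then show "x \<in> box (lo (1/4) z) (hi (1/4) z)"
      by (auto simp: mem_box_cart lo_def hi_def)
  qed
  have "\<exists>u. cbox (lo (1/4) z) (hi (1/4) z) \<subseteq> W (par z) u" if z: "z \<in> Z" for z
  proof -
    obtain x where x: "x \<in> K" "x \<in> cbox (lo 0 z) (hi 0 z)" using z by (auto simp: Z_def)
    have "x \<in> cbox (lo (1/4) z) (hi (1/4) z)"
      using x(2) grow box_subset_cbox by blast
    then have "cbox (lo (1/4) z) (hi (1/4) z) \<subseteq> ball x e" using diam by auto
    moreover obtain h where "ball x e \<subseteq> (\<Inter>b. W b (h b))" using e(2)[OF x(1)] by auto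
    ultimately show ?thesis by blast
  qed
  then obtain h where h: "\<And>z. z \<in> Z \<Longrightarrow> cbox (lo (1/4) z) (hi (1/4) z) \<subseteq> W (par z) (h z)"
    by metis
  define J where "J b u = {z \<in> Z. par z = b \<and> h z = u}" for b u
  have J: "finite (J b u)" for b u using \<open>finite Z\<close> by (simp add: J_def)
  \<comment> \<open>If two enlarged cubes meet, their integer indices differ by at most 3/2, hence
    by at most 1, in each coordinate; equal parity then leaves 0.\<close>
  have same: "z = z'" if "par z = par z'" "x \<in> cbox (lo (1/4) z) (hi (1/4) z)"
      "x \<in> cbox (lo (1/4) z') (hi (1/4) z')" for z z' x
  proof
    fix i
    have "(z i - 1/4) * s \<le> x $ i" "x $ i \<le> (z i + 1 + 1/4) * s"
      "(z' i - 1/4) * s \<le> x $ i" "x $ i \<le> (z' i + 1 + 1/4) * s"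
      using that by (auto simp: mem_box_cart lo_def hi_def)
    then have "(z i - 1/4) * s \<le> (z' i + 1 + 1/4) * s" "(z' i - 1/4) * s \<le> (z i + 1 + 1/4) * s"
      by linarith+
    then have "z i - 1/4 \<le> z' i + 1 + 1/4" "z' i - 1/4 \<le> z i + 1 + 1/4"
      using s by (simp_all only: mult_le_cancel_right_pos)
    then have "\<bar>z i - z' i\<bar> \<le> 1" by linarith
    moreover have "even (z i) \<longleftrightarrow> even (z' i)" using that(1) by (auto simp: par_def)
    ultimately show "z i = z' i" by presburger
  qed
  show thesis
  proof (rule that[of "\<lambda>b u. \<Union>z\<in>J b u. cbox (lo 0 z) (hi 0 z)"
        "\<lambda>b u. \<Union>z\<in>J b u. box (lo (1/4) z) (hi (1/4) z)"
        "\<lambda>b u. \<Union>z\<in>J b u. cbox (lo (1/4) z) (hi (1/4) z)"])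
    fix b u
    show "(\<Union>z\<in>J b u. cbox (lo 0 z) (hi 0 z)) \<subseteq> (\<Union>z\<in>J b u. box (lo (1/4) z) (hi (1/4) z))"
      using grow by (intro UN_mono) auto
    show "(\<Union>z\<in>J b u. cbox (lo (1/4) z) (hi (1/4) z)) \<subseteq> W b u"
      using h by (auto simp: J_def)
    fix v assume "u \<noteq> v"
    then show "(\<Union>z\<in>J b u. cbox (lo (1/4) z) (hi (1/4) z)) \<inter>
        (\<Union>z\<in>J b v. cbox (lo (1/4) z) (hi (1/4) z)) = {}"
      using same unfolding J_def by blast
  next
    show "K \<subseteq> (\<Union>b. \<Union>u. \<Union>z\<in>J b u. cbox (lo 0 z) (hi 0 z))"
    proof
      fix x assume x: "x \<in> K"
      define z where "z = (\<lambda>i. \<lfloor>x $ i / s\<rfloor>)"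
      have "z i \<le> x $ i / s" "x $ i / s \<le> z i + 1" for i
        unfolding z_def by linarith+
      then have "z i * s \<le> x $ i" "x $ i \<le> (z i + 1) * s" for i
        using s by (simp_all only: pos_le_divide_eq pos_divide_le_eq)
      then have "x \<in> cbox (lo 0 z) (hi 0 z)"
        by (auto simp: mem_box_cart lo_def hi_def)
      then have "z \<in> J (par z) (h z)" using x by (auto simp: J_def Z_def)
      then show "x \<in> (\<Union>b. \<Union>u. \<Union>z\<in>J b u. cbox (lo 0 z) (hi 0 z))"
        using \<open>x \<in> cbox (lo 0 z) (hi 0 z)\<close> by blast
    qed
  next
    fix b u
    show "(\<Union>z\<in>J b u. box (lo (1/4) z) (hi (1/4) z)) \<subseteq> (\<Union>z\<in>J b u. cbox (lo (1/4) z) (hi (1/4) z))"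
      by (intro UN_mono box_subset_cbox) auto
  qed (use J in \<open>auto intro!: compact_UN\<close>)
qed

section \<open>Upper semicontinuity of maps with finite values\<close>

lemma exp_space_valued_finite:
  assumes f: "continuous_map (top_of_set X) (exp_space n euclidean) f" and x: "x \<in> X"
  shows "finite (f x)" "card (f x) \<le> n"
  using continuous_map_image_subset_topspace[OF f] x by (auto simp: topspace_exp_space)

text \<open>This is the form in which continuity of \<open>f\<close> enters the construction of the
  separating functions.\<close>

lemma exp_space_valued_open_preimage:
  assumes f: "continuous_map (top_of_set X) (exp_space n euclidean) f" and U: "open U"
  obtains V where "open V" "{x \<in> X. f x \<subseteq> U} = X \<inter> V"
proof -
  have "openin (top_of_set X) {x \<in> topspace (top_of_set X). f x \<in> {A \<in> topspace (exp_space n euclidean). A \<subseteq> U}}"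
    by (rule openin_continuous_map_preimage[OF f openin_exp_space_sub]) (use U in auto)
  moreover have "{x \<in> topspace (top_of_set X). f x \<in> {A \<in> topspace (exp_space n euclidean). A \<subseteq> U}} =
      {x \<in> X. f x \<subseteq> U}"
    using continuous_map_image_subset_topspace[OF f] by auto
  ultimately show thesis using that by (auto simp: openin_open)
qed

section \<open>Colouring cells along a well-founded order\<close>

text \<open>Recursion along \<open>r\<close> chooses for each cell one function per parity class, so
  that every \<open>x\<close> of the cell has a class in which its value stays
  \<open>\<delta>\<close> away from the values at all points of \<open>f x\<close> in earlier cells.
  There are \<open>n + 1\<close> candidate levels, and in each class the at most \<open>n\<close>
  points of \<open>f x\<close> block at most \<open>n\<close> of them.\<close>

lemma decreasing_edges_finitely_separated:
  fixes X :: "(real^'k) set" and E :: "'i \<Rightarrow> (real^'k) set"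
  assumes f: "continuous_map (top_of_set X) (exp_space n euclidean) f" and X: "closed X"
    and r: "wf r"
    and E: "\<And>i. compact (E i)"
    and fin: "\<And>R. finite {i. E i \<inter> ball 0 R \<noteq> {}}"
    and disj: "\<And>i j. i \<noteq> j \<Longrightarrow> E i \<inter> E j = {}"
  shows "finitely_separated {(x, y). \<exists>i j. (j, i) \<in> r \<and> x \<in> X \<inter> E i \<and> y \<in> f x \<inter> E j}"
proof -
  \<comment> \<open>The levels \<open>3 * \<delta> * real u\<close> with \<open>u \<le> n\<close>
    lie in the unit interval, and the closed bands of radius \<open>\<delta>\<close> around them are
    disjoint.\<close>
  define \<delta> where "\<delta> = 1 / (3 * (real n + 1))"
  have \<delta>: "0 < \<delta>" by (simp add: \<delta>_def)
  have level: "3 * \<delta> * real u \<in> {0..1}" if "u \<le> n" for u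
    using that by (simp add: \<delta>_def field_simps)
  \<comment> \<open>The class \<open>b\<close> may depend on \<open>x\<close>. The condition reads
    \<open>\<phi>\<close> only at predecessors of \<open>i\<close>, as the recursion
    demands.\<close>
  define Q where "Q \<phi> i \<psi> \<longleftrightarrow> (\<forall>b. continuous_on UNIV (\<psi> b) \<and> (\<forall>x. \<psi> b x \<in> {0..1})) \<and>
      (\<forall>x\<in>X \<inter> E i. \<exists>b. \<forall>j y. (j, i) \<in> r \<longrightarrow> y \<in> f x \<inter> E j \<longrightarrow> \<delta> \<le> \<bar>\<psi> b x - \<phi> j b y\<bar>)"
    for \<phi> :: "'i \<Rightarrow> 'k set \<Rightarrow> real^'k \<Rightarrow> real" and i \<psi>
  have "\<exists>\<phi>. \<forall>i. Q \<phi> i (\<phi> i)"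
  proof (rule dependent_wf_choice[OF r])
    fix \<phi> \<phi>' :: "'i \<Rightarrow> 'k set \<Rightarrow> real^'k \<Rightarrow> real" and i \<psi>
    assume "\<And>j. (j, i) \<in> r \<Longrightarrow> \<phi> j = \<phi>' j"
    then show "Q \<phi> i \<psi> = Q \<phi>' i \<psi>"
      unfolding Q_def by (simp cong: imp_cong)
  next
    fix i and \<phi> :: "'i \<Rightarrow> 'k set \<Rightarrow> real^'k \<Rightarrow> real"
    assume IH: "\<And>j. (j, i) \<in> r \<Longrightarrow> Q \<phi> j (\<phi> j)"
    \<comment> \<open>The points of earlier cells that block level \<open>u\<close>. A whole band is
      excluded, since away from the sets that carry exact levels the earlier functions take
      uncontrolled values.\<close>
    define F where "F b u = (\<Union>j\<in>{j. (j, i) \<in> r}. E j \<inter> {y. \<bar>\<phi> j b y - 3 * \<delta> * real u\<bar> \<le> \<delta>})" for b u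
    have F: "closed (F b u)" for b u
      unfolding F_def
    proof (rule closed_UN_locally_finite)
      fix j assume "j \<in> {j. (j, i) \<in> r}"
      then have "continuous_on UNIV (\<phi> j b)" using IH by (auto simp: Q_def)
      then show "closed (E j \<inter> {y. \<bar>\<phi> j b y - 3 * \<delta> * real u\<bar> \<le> \<delta>})"
        using E by (intro closed_Int closed_Collect_le continuous_intros) (auto intro: compact_imp_closed)
    next
      fix R
      show "finite {j \<in> {j. (j, i) \<in> r}. E j \<inter> {y. \<bar>\<phi> j b y - 3 * \<delta> * real u\<bar> \<le> \<delta>} \<inter> ball 0 R \<noteq> {}}"
        by (rule finite_subset[OF _ fin[of R]]) auto
    qed
    \<comment> \<open>Pigeonhole: a point lies in at most one cell and its value in at most one
      band, so blocking all \<open>n + 1\<close> levels would take \<open>n + 1\<close> distinct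
      points of \<open>f x\<close>.\<close>
    have free: "\<exists>u\<le>n. f x \<inter> F b u = {}" if x: "x \<in> X" for x b
    proof (rule ccontr)
      assume "\<not> (\<exists>u\<le>n. f x \<inter> F b u = {})"
      then have "\<forall>u. \<exists>y. u \<le> n \<longrightarrow> y \<in> f x \<inter> F b u" by blast
      then obtain Y where Y: "\<And>u. u \<le> n \<Longrightarrow> Y u \<in> f x \<inter> F b u" by metis
      have "inj_on Y {..n}"
      proof (rule inj_onI)
        fix u v assume uv: "u \<in> {..n}" "v \<in> {..n}" "Y u = Y v"
        obtain j where j: "Y u \<in> E j" "\<bar>\<phi> j b (Y u) - 3 * \<delta> * real u\<bar> \<le> \<delta>"
          using Y[of u] uv by (auto simp: F_def)
        obtain j' where j': "Y u \<in> E j'" "\<bar>\<phi> j' b (Y u) - 3 * \<delta> * real v\<bar> \<le> \<delta>"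
          using Y[of v] uv by (auto simp: F_def)
        have "j' = j" using disj[of j' j] j j' by blast
        with j' have "\<bar>\<phi> j b (Y u) - 3 * \<delta> * real v\<bar> \<le> \<delta>" by simp
        with j(2) have "\<bar>3 * \<delta> * real u - 3 * \<delta> * real v\<bar> \<le> 2 * \<delta>" by linarith
        moreover have "\<bar>3 * \<delta> * real u - 3 * \<delta> * real v\<bar> = \<delta> * (3 * \<bar>real u - real v\<bar>)"
          using \<delta> by (simp add: abs_mult flip: right_diff_distrib)
        ultimately have "\<delta> * (3 * \<bar>real u - real v\<bar>) \<le> \<delta> * 2" by (simp add: mult.commute)
        then have "3 * \<bar>real u - real v\<bar> \<le> 2" using \<delta> by simp
        then show "u = v" by (cases u v rule: linorder_cases) auto
      qed
      moreover have "Y ` {..n} \<subseteq> f x" using Y by auto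
      ultimately have "card {..n} \<le> card (f x)"
        using exp_space_valued_finite(1)[OF f x] by (intro card_inj_on_le)
      then show False using exp_space_valued_finite(2)[OF f x] by simp
    qed
    define V where "V b u = (SOME V. open V \<and> {x \<in> X. f x \<subseteq> - F b u} = X \<inter> V)" for b u
    have V: "open (V b u) \<and> {x \<in> X. f x \<subseteq> - F b u} = X \<inter> V b u" for b u
    proof -
      have "open (- F b u)" using F by (rule open_Compl)
      then obtain V' where "open V'" "{x \<in> X. f x \<subseteq> - F b u} = X \<inter> V'"
        by (rule exp_space_valued_open_preimage[OF f])
      then have "\<exists>V'. open V' \<and> {x \<in> X. f x \<subseteq> - F b u} = X \<inter> V'" by blast
      then show ?thesis unfolding V_def by (rule someI_ex)
    qed
    \<comment> \<open>The empty set beyond level \<open>n\<close> forces \<open>A b u\<close> to be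
      empty there.\<close>
    define W where "W b u = (if u \<le> n then V b u else {})" for b u
    have K: "compact (X \<inter> E i)" using X E by (simp add: closed_Int_compact)
    have W: "open (W b u)" for b u using V[of b u] by (simp add: W_def)
    have cover: "X \<inter> E i \<subseteq> (\<Union>u. W b u)" for b
    proof
      fix x assume x: "x \<in> X \<inter> E i"
      then obtain u where "u \<le> n" "f x \<inter> F b u = {}" using free by blast
      then have "x \<in> W b u" using V[of b u] x by (auto simp: W_def)
      then show "x \<in> (\<Union>u. W b u)" by blast
    qed
    \<comment> \<open>Which levels are blocked depends on the class, so each \<open>b\<close> brings
      its own cover.\<close>
    obtain P B A where PBA: "\<And>b u. compact (P b u)" "\<And>b u. open (B b u)" "\<And>b u. compact (A b u)"
      "\<And>b u. P b u \<subseteq> B b u" "\<And>b u. B b u \<subseteq> A b u" "\<And>b u. A b u \<subseteq> W b u"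
      "\<And>b u v. u \<noteq> v \<Longrightarrow> A b u \<inter> A b v = {}" "X \<inter> E i \<subseteq> (\<Union>b. \<Union>u. P b u)"
      by (rule parity_class_cells[of "X \<inter> E i" W, OF K W cover]) blast
    note A = PBA(3,6,7) and P = PBA(4,5,8)
    have "\<exists>\<psi>. continuous_on UNIV \<psi> \<and> (\<forall>x. \<psi> x \<in> {0..1}) \<and> (\<forall>u x. x \<in> A b u \<longrightarrow> \<psi> x = 3 * \<delta> * real u)" for b
    proof -
      have out: "u \<le> n" if "x \<in> A b u" for u x using A(2)[of b u] that by (auto simp: W_def split: if_splits)
      \<comment> \<open>The value 0 beyond level \<open>n\<close> only keeps the range in the unit
        interval, as those sets are empty.\<close>
      obtain \<psi> where "continuous_on UNIV \<psi>" "\<And>x. \<psi> x \<in> {0..1}"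
        "\<And>u x. x \<in> A b u \<Longrightarrow> \<psi> x = (if u \<le> n then 3 * \<delta> * real u else 0)"
      proof (rule paste_locally_finite_disjoint[of "A b" "\<lambda>u x. if u \<le> n then 3 * \<delta> * real u else 0"])
        show "finite {u. A b u \<inter> ball 0 R \<noteq> {}}" for R
          by (rule finite_subset[of _ "{..n}"]) (use out in auto)
        show "(if u \<le> n then 3 * \<delta> * real u else 0) \<in> {0..1}" for u using level by simp
      qed (use A in \<open>auto intro: compact_imp_closed\<close>)
      then show ?thesis using out by (intro exI[of _ \<psi>]) auto
    qed
    then obtain \<psi> where "\<forall>b. continuous_on UNIV (\<psi> b) \<and> (\<forall>x. \<psi> b x \<in> {0..1}) \<and>
        (\<forall>u x. x \<in> A b u \<longrightarrow> \<psi> b x = 3 * \<delta> * real u)"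
      using choice[of "\<lambda>b \<psi>. continuous_on UNIV \<psi> \<and> (\<forall>x. \<psi> x \<in> {0..1}) \<and>
        (\<forall>u x. x \<in> A b u \<longrightarrow> \<psi> x = 3 * \<delta> * real u)"] by blast
    then have \<psi>: "\<And>b. continuous_on UNIV (\<psi> b)" "\<And>b x. \<psi> b x \<in> {0..1}"
      "\<And>b u x. x \<in> A b u \<Longrightarrow> \<psi> b x = 3 * \<delta> * real u" by blast+
    have "\<exists>b. \<forall>j y. (j, i) \<in> r \<longrightarrow> y \<in> f x \<inter> E j \<longrightarrow> \<delta> \<le> \<bar>\<psi> b x - \<phi> j b y\<bar>" if x: "x \<in> X \<inter> E i" for x
    proof -
      obtain b u where "x \<in> P b u" using P(3) x by blast
      then have xA: "x \<in> A b u" using P(1,2) by blast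
      then have "x \<in> V b u" using A(2)[of b u] by (auto simp: W_def split: if_splits)
      \<comment> \<open>At \<open>x\<close> the new function has exactly level \<open>u\<close>,
        while every point of \<open>f x\<close> in an earlier cell has its value outside the band of
        that level.\<close>
      then have "f x \<subseteq> - F b u" using V[of b u] x by blast
      then have "\<delta> \<le> \<bar>\<psi> b x - \<phi> j b y\<bar>" if "(j, i) \<in> r" "y \<in> f x \<inter> E j" for j y
        using that \<psi>(3)[OF xA] by (force simp: F_def)
      then show ?thesis by blast
    qed
    then have "Q \<phi> i \<psi>" unfolding Q_def using \<psi> by blast
    then show "\<exists>\<psi>. Q \<phi> i \<psi>" by (rule exI[of _ \<psi>])
  qed
  then obtain \<phi> where \<phi>: "\<And>i. Q \<phi> i (\<phi> i)" by blast
  \<comment> \<open>The cells are disjoint, so the functions of one class paste to a single global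
    function; finitely many classes give a finite family.\<close>
  have "\<exists>\<Phi>. continuous_on UNIV \<Phi> \<and> (\<forall>x. \<Phi> x \<in> {0..1}) \<and> (\<forall>i x. x \<in> E i \<longrightarrow> \<Phi> x = \<phi> i b x)" for b
  proof -
    have "continuous_on UNIV (\<phi> i b)" "\<phi> i b x \<in> {0..1}" for i x
      using \<phi>[of i] unfolding Q_def by blast+
    then obtain \<Phi> where "continuous_on UNIV \<Phi>" "\<And>x. \<Phi> x \<in> {0..1}" "\<And>i x. x \<in> E i \<Longrightarrow> \<Phi> x = \<phi> i b x"
      using paste_locally_finite_disjoint[of E "\<lambda>i. \<phi> i b", OF compact_imp_closed[OF E] fin disj] by blast
    then show ?thesis by blast
  qed
  then obtain \<Phi> where "\<forall>b. continuous_on UNIV (\<Phi> b) \<and> (\<forall>x. \<Phi> b x \<in> {0..1}) \<and>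
      (\<forall>i x. x \<in> E i \<longrightarrow> \<Phi> b x = \<phi> i b x)"
    using choice[of "\<lambda>b \<Phi>. continuous_on UNIV \<Phi> \<and> (\<forall>x. \<Phi> x \<in> {0..1}) \<and>
      (\<forall>i x. x \<in> E i \<longrightarrow> \<Phi> x = \<phi> i b x)"] by blast
  then have \<Phi>: "\<And>b. continuous_on UNIV (\<Phi> b)" "\<And>b x. \<Phi> b x \<in> {0..1}"
    "\<And>b i x. x \<in> E i \<Longrightarrow> \<Phi> b x = \<phi> i b x" by blast+
  show ?thesis
  proof (rule finitely_separatedI[of "range \<Phi>" \<delta>])
    fix x y assume "(x, y) \<in> {(x, y). \<exists>i j. (j, i) \<in> r \<and> x \<in> X \<inter> E i \<and> y \<in> f x \<inter> E j}"
    then obtain i j where ij: "(j, i) \<in> r" "x \<in> X \<inter> E i" "y \<in> f x \<inter> E j" by blast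
    then obtain b where "\<delta> \<le> \<bar>\<phi> i b x - \<phi> j b y\<bar>" using \<phi>[of i] unfolding Q_def by blast
    then have "\<delta> \<le> \<bar>\<Phi> b x - \<Phi> b y\<bar>" using ij \<Phi>(3) by auto
    then show "\<exists>c\<in>range \<Phi>. \<delta> \<le> \<bar>c x - c y\<bar>" by blast
  qed (use \<Phi> \<delta> in auto)
qed

section \<open>Bounds and small cells over compact sets\<close>

text \<open>Upper semicontinuity for balls of integer radius gives an open cover of
  \<open>K\<close>. The bound will determine the radii of the annuli.\<close>

lemma exp_space_valued_bounded:
  fixes X :: "'a::real_normed_vector set" and f :: "'a \<Rightarrow> 'a set"
  assumes f: "continuous_map (top_of_set X) (exp_space n euclidean) f"
    and K: "compact K" "K \<subseteq> X"
  obtains R where "\<And>x. x \<in> K \<Longrightarrow> f x \<subseteq> ball 0 R"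
proof -
  have "\<exists>V. open V \<and> {x \<in> X. f x \<subseteq> ball 0 (real m)} = X \<inter> V" for m
    using exp_space_valued_open_preimage[OF f, of "ball 0 (real m)"] by blast
  then obtain V where V: "\<And>m. open (V m) \<and> {x \<in> X. f x \<subseteq> ball 0 (real m)} = X \<inter> V m"
    by metis
  have "\<exists>m. x \<in> V m" if x: "x \<in> K" for x
  proof -
    have "bounded (f x)"
      using exp_space_valued_finite(1)[OF f] x K by (auto intro: finite_imp_bounded)
    then obtain B where B: "\<And>y. y \<in> f x \<Longrightarrow> norm y \<le> B" by (auto simp: bounded_iff)
    obtain m :: nat where "B < real m" using reals_Archimedean2 by blast
    then have "f x \<subseteq> ball 0 (real m)" using B by fastforce
    then show ?thesis using V[of m] x K by blast
  qed
  then have cover: "K \<subseteq> (\<Union>m\<in>UNIV. V m)" by blast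
  have "open (V m)" for m using V by blast
  then obtain M where M: "M \<subseteq> UNIV" "finite M" "K \<subseteq> (\<Union>m\<in>M. V m)"
    using compactE_image[OF K(1) _ cover] by metis
  show thesis
  proof (rule that)
    fix x assume x: "x \<in> K"
    then obtain m where m: "m \<in> M" "x \<in> V m" using M by blast
    then have "f x \<subseteq> ball 0 (real m)" using V[of m] x K by blast
    also have "\<dots> \<subseteq> ball 0 (real (Max M))"
      using M(2) m(1) by (intro subset_ball) simp
    finally show "f x \<subseteq> ball 0 (real (Max M))" .
  qed
qed

text \<open>The finite set \<open>f x\<close> is closed, so it misses a closed ball about
  \<open>x\<close>; by upper semicontinuity nearby values miss that ball too.\<close>

lemma fixed_point_free_nhd:
  fixes X :: "'a::metric_space set" and f :: "'a \<Rightarrow> 'a set"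
  assumes f: "continuous_map (top_of_set X) (exp_space n euclidean) f"
    and x: "x \<in> X" "x \<notin> f x"
  obtains U where "open U" "x \<in> U" "\<And>x'. x' \<in> X \<inter> U \<Longrightarrow> f x' \<inter> U = {}"
proof -
  have "open (- f x)" using exp_space_valued_finite(1)[OF f x(1)] by (simp add: finite_imp_closed open_Compl)
  then obtain e where e: "0 < e" "cball x e \<subseteq> - f x"
    using x(2) by (auto simp: open_contains_cball)
  obtain V where V: "open V" "{x' \<in> X. f x' \<subseteq> - cball x e} = X \<inter> V"
    using exp_space_valued_open_preimage[OF f, of "- cball x e"] by blast
  show thesis
  proof (rule that[of "ball x e \<inter> V"])
    show "x \<in> ball x e \<inter> V" using V(2) x e by auto
    show "f x' \<inter> (ball x e \<inter> V) = {}" if "x' \<in> X \<inter> (ball x e \<inter> V)" for x'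
    proof -
      have "f x' \<subseteq> - cball x e" using that V(2) by blast
      then show ?thesis using ball_subset_cball[of x e] by blast
    qed
  qed (use V in auto)
qed

text \<open>A finite subcover by neighbourhoods as in \<open>fixed_point_free_nhd\<close> is used
  for every class alike. Cutting with \<open>N\<close> confines the cells, and \<open>p\<close>
  bounds the indices of the non-empty ones, so that their order can later be reversed.\<close>

lemma fixed_point_free_cells:
  fixes X :: "(real^'k) set"
  assumes f: "continuous_map (top_of_set X) (exp_space n euclidean) f"
    and ff: "\<And>x. x \<in> X \<Longrightarrow> x \<notin> f x"
    and K: "compact K" "K \<subseteq> X" and N: "open N" "K \<subseteq> N"
  shows "\<exists>p P V E.
    (\<forall>b :: 'k set. \<forall>u :: nat. compact (P b u) \<and> open (V b u) \<and> compact (E b u) \<and>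
       P b u \<subseteq> V b u \<and> V b u \<subseteq> E b u \<and> E b u \<subseteq> N \<and> (E b u \<noteq> {} \<longrightarrow> u < p) \<and>
       (\<forall>v. u \<noteq> v \<longrightarrow> E b u \<inter> E b v = {}) \<and> (\<forall>x\<in>X \<inter> E b u. f x \<inter> E b u = {})) \<and>
    K \<subseteq> (\<Union>b. \<Union>u. P b u)"
proof -
  define good where "good x U \<longleftrightarrow> open U \<and> x \<in> U \<and> (\<forall>x'\<in>X \<inter> U. f x' \<inter> U = {})" for x U
  have "\<exists>U. good x U" if x: "x \<in> X" for x
  proof -
    obtain U where "open U" "x \<in> U" "\<And>x'. x' \<in> X \<inter> U \<Longrightarrow> f x' \<inter> U = {}"
      using fixed_point_free_nhd[OF f x ff[OF x]] by blast
    then show ?thesis unfolding good_def by (intro exI[of _ U]) simp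
  qed
  then obtain U where "\<And>x. x \<in> X \<Longrightarrow> good x (U x)" by metis
  then have U: "open (U x) \<and> x \<in> U x \<and> (\<forall>x'\<in>X \<inter> U x. f x' \<inter> U x = {})" if "x \<in> X" for x
    using that unfolding good_def by blast
  have "\<And>x. x \<in> K \<Longrightarrow> open (U x)" "K \<subseteq> (\<Union>x\<in>K. U x)" using U K by blast+
  then obtain M where M: "M \<subseteq> K" "finite M" "K \<subseteq> (\<Union>x\<in>M. U x)"
    by (rule compactE_image[OF K(1)])
  obtain h where h: "bij_betw h {0..<card M} M" using ex_bij_betw_nat_finite[OF M(2)] by blast
  define W where "W b u = (if u < card M then U (h u) \<inter> N else {})" for b :: "'k set" and u
  have hX: "h u \<in> X" if "u < card M" for u
  proof -
    have "h u \<in> M" using h that by (auto simp: bij_betw_def)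
    then show ?thesis using M(1) K(2) by blast
  qed
  have W: "open (W b u)" for b u using U[OF hX] N by (simp add: W_def open_Int)
  have cover: "K \<subseteq> (\<Union>u. W b u)" for b
  proof
    fix x assume x: "x \<in> K"
    then obtain a where a: "a \<in> M" "x \<in> U a" using M by blast
    then have "a \<in> h ` {0..<card M}" using h by (simp add: bij_betw_def)
    then obtain u where "u < card M" "h u = a" by auto
    then have "x \<in> W b u" using a x N by (auto simp: W_def)
    then show "x \<in> (\<Union>u. W b u)" by blast
  qed
  obtain P V E where PVE: "\<And>b u. compact (P b u)" "\<And>b u. open (V b u)" "\<And>b u. compact (E b u)"
      "\<And>b u. P b u \<subseteq> V b u" "\<And>b u. V b u \<subseteq> E b u" "\<And>b u. E b u \<subseteq> W b u"
      "\<And>b u v. u \<noteq> v \<Longrightarrow> E b u \<inter> E b v = {}" "K \<subseteq> (\<Union>b. \<Union>u. P b u)"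
    by (rule parity_class_cells[of K W, OF K(1) W cover]) blast
  have lt: "u < card M" if "E b u \<noteq> {}" for b u
    using that PVE(6)[of b u] by (auto simp: W_def split: if_splits)
  have EU: "E b u \<subseteq> U (h u) \<inter> N" if "u < card M" for b u
    using PVE(6)[of b u] that by (simp add: W_def)
  have "E b u \<subseteq> N" for b u using lt EU by blast
  moreover have "f x \<inter> E b u = {}" if "x \<in> X \<inter> E b u" for b u x
  proof -
    have u: "u < card M" using lt that by blast
    then have "f x \<inter> U (h u) = {}" using U[OF hX[OF u]] EU[OF u, of b] that by blast
    then show ?thesis using EU[OF u, of b] by blast
  qed
  ultimately show ?thesis
    using PVE lt by (intro exI[of _ "card M"] exI[of _ P] exI[of _ V] exI[of _ E]) simp
qed

section \<open>Annuli and the two orders of cells\<close>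

text \<open>For each level parity \<open>q\<close> and class \<open>b\<close>, the graph pairs
  starting in a core split into those that leave the open sets \<open>V\<close> and those that
  decrease for one of two well-founded orders.\<close>

lemma graph_finitely_separated:
  fixes X :: "(real^'k) set"
  assumes f: "continuous_map (top_of_set X) (exp_space n euclidean) f" and X: "closed X"
    and ff: "\<And>x. x \<in> X \<Longrightarrow> x \<notin> f x"
  shows "finitely_separated {(x, y). x \<in> X \<and> y \<in> f x}"
proof -
  have "\<exists>R. \<forall>x\<in>X \<inter> cball 0 a. f x \<subseteq> ball 0 R" for a
    using exp_space_valued_bounded[OF f, of "X \<inter> cball 0 a"] X by (metis Int_lower1 closed_Int_compact compact_cball)
  then obtain \<rho> where \<rho>: "\<And>a. \<forall>x\<in>X \<inter> cball 0 a. f x \<subseteq> ball 0 (\<rho> a)" by metis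
  \<comment> \<open>The first term spaces the radii by at least 1; the second makes \<open>f\<close>
    carry the ball of radius \<open>r l + 1\<close> into the ball of radius
    \<open>r (Suc l) - 1\<close>.\<close>
  define r :: "nat \<Rightarrow> real" where "r = rec_nat 0 (\<lambda>_ a. max (a + 1) (\<rho> (a + 1) + 1))"
  have r0: "r 0 = 0" by (simp add: r_def)
  have rS: "r l + 1 \<le> r (Suc l)" for l by (simp add: r_def)
  have rf: "f x \<subseteq> ball 0 (r (Suc l) - 1)" if "x \<in> X" "norm x \<le> r l + 1" for x l
  proof -
    have "f x \<subseteq> ball 0 (\<rho> (r l + 1))" using \<rho>[of "r l + 1"] that by auto
    also have "\<dots> \<subseteq> ball 0 (r (Suc l) - 1)" by (intro subset_ball) (simp add: r_def)
    finally show ?thesis .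
  qed
  have rmono: "r l \<le> r m" if "l \<le> m" for l m
    by (rule lift_Suc_mono_le[OF _ that]) (use rS in \<open>smt (verit)\<close>)
  have rl: "real l \<le> r l" for l
  proof (induction l)
    case (Suc l) then show ?case using rS[of l] by simp
  qed (simp add: r0)
  \<comment> \<open>Annuli thickened by 1/2: as the radii are at least 1 apart, those whose levels
    differ by two or more stay disjoint.\<close>
  define N where "N l = {x :: real^'k. r l - 1/2 < norm x \<and> norm x < r (Suc l) + 1/2}" for l
  define K where "K l = X \<inter> (cball 0 (r (Suc l)) \<inter> {x. r l \<le> norm x})" for l
  define cells where "cells l p P V E \<longleftrightarrow>
    (\<forall>b :: 'k set. \<forall>u :: nat. compact (P b u) \<and> open (V b u) \<and> compact (E b u) \<and>
       P b u \<subseteq> V b u \<and> V b u \<subseteq> E b u \<and> E b u \<subseteq> N l \<and> (E b u \<noteq> {} \<longrightarrow> u < p) \<and>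
       (\<forall>v. u \<noteq> v \<longrightarrow> E b u \<inter> E b v = {}) \<and> (\<forall>x\<in>X \<inter> E b u. f x \<inter> E b u = {})) \<and>
    K l \<subseteq> (\<Union>b. \<Union>u. P b u)" for l p P V E
  have "\<exists>p P V E. cells l p P V E" for l
    unfolding cells_def
  proof (rule fixed_point_free_cells[OF f ff])
    show "compact (K l)"
      unfolding K_def using X
      by (intro closed_Int_compact compact_Int_closed compact_cball closed_Collect_le continuous_intros) auto
    show "open (N l)"
      unfolding N_def by (intro open_Collect_conj open_Collect_less continuous_intros)
  qed (auto simp: K_def N_def)
  then obtain p P V E where cells: "\<And>l. cells l (p l) (P l) (V l) (E l)" by metis
  have P: "compact (P l b u)" and V: "open (V l b u)" and E: "compact (E l b u)"
    and PV: "P l b u \<subseteq> V l b u" and VE: "V l b u \<subseteq> E l b u" and EN: "E l b u \<subseteq> N l"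
    and Ep: "E l b u \<noteq> {} \<Longrightarrow> u < p l" and Edisj: "u \<noteq> v \<Longrightarrow> E l b u \<inter> E l b v = {}"
    and Ef: "x \<in> X \<inter> E l b u \<Longrightarrow> f x \<inter> E l b u = {}"
    and KP: "K l \<subseteq> (\<Union>b. \<Union>u. P l b u)" for l b u v x
    using cells[of l] unfolding cells_def by blast+
  \<comment> \<open>Fixing the parity \<open>q\<close> of the level discards neighbouring annuli,
    whose cells might overlap; the discarded indices get empty cells.\<close>
  define D where "D q b = (\<lambda>(l, u). if l mod 2 = q then E l b u else {})" for q :: nat and b
  define S where "S q b = (\<Union>(l, u)\<in>{l. l mod 2 = q} \<times> UNIV. P l b u)" for q :: nat and b
  define O' where "O' q b = (\<Union>(l, u)\<in>{l. l mod 2 = q} \<times> UNIV. V l b u)" for q :: nat and b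
  define lex1 where "lex1 = less_than <*lex*> less_than"
  \<comment> \<open>Subtracting from \<open>p l\<close> reverses the order within a level and keeps
    it well-founded; levels are still compared first.\<close>
  define lex2 where "lex2 = inv_image (less_than <*lex*> less_than) (\<lambda>(l, u). (l, p l - u))"
  define \<Gamma> where "\<Gamma> q b t = {(x, y). \<exists>i j. (j, i) \<in> t \<and> x \<in> X \<inter> D q b i \<and> y \<in> f x \<inter> D q b j}" for q b t
  have D: "compact (D q b i)" for q b i using E by (cases i) (simp add: D_def)
  have Efin: "finite {(l, u). E l b u \<inter> ball 0 R \<noteq> {}}" for b R
  proof (rule finite_subset)
    show "{(l, u). E l b u \<inter> ball 0 R \<noteq> {}} \<subseteq> (SIGMA l:{..nat \<lceil>R + 1\<rceil>}. {..<p l})"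
    proof clarify
      fix l u assume ne: "E l b u \<inter> ball 0 R \<noteq> {}"
      then obtain x where "x \<in> N l" "norm x < R" using EN by fastforce
      then have "real l < R + 1" using rl[of l] by (auto simp: N_def)
      then have "l \<le> nat \<lceil>R + 1\<rceil>" by linarith
      moreover have "u < p l" using ne Ep by blast
      ultimately show "l \<in> {..nat \<lceil>R + 1\<rceil>} \<and> u \<in> {..<p l}" by simp
    qed
  qed auto
  have Dfin: "finite {i. D q b i \<inter> ball 0 R \<noteq> {}}" for q b R
    by (rule finite_subset[OF _ Efin[of b R]]) (auto simp: D_def split: if_splits)
  have far: "N l \<inter> N m = {}" if "Suc l < m" for l m
  proof -
    have "r (Suc l) + 1 \<le> r m" using rS[of "Suc l"] rmono[of "Suc (Suc l)" m] that by linarith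
    then show ?thesis by (auto simp: N_def)
  qed
  have Ddisj: "D q b i \<inter> D q b j = {}" if "i \<noteq> j" for q b i j
  proof -
    obtain l u m v where ij: "i = (l, u)" "j = (m, v)" by fastforce
    have "E l b u \<inter> E m b v = {}" if "l mod 2 = q" "m mod 2 = q"
    proof (cases "l = m")
      case True
      then show ?thesis using Edisj[of u v l b] \<open>i \<noteq> j\<close> ij by simp
    next
      case False
      then have "Suc l < m \<or> Suc m < l" using that by presburger
      then have "N l \<inter> N m = {}" using far[of l m] far[of m l] by blast
      then show ?thesis using EN[of l b u] EN[of m b v] by blast
    qed
    then show ?thesis by (simp add: D_def ij)
  qed
  have \<Gamma>: "finitely_separated (\<Gamma> q b t)" if "wf t" for q b t
    unfolding \<Gamma>_def by (rule decreasing_edges_finitely_separated[OF f X that D Dfin Ddisj])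
  have SO: "finitely_separated (S q b \<times> - O' q b)" for q b
  proof (rule finitely_separated_closed_Times)
    show "closed (S q b)"
      unfolding S_def
    proof (rule closed_UN_locally_finite)
      show "closed (case i of (l, u) \<Rightarrow> P l b u)" for i
        using P by (cases i) (simp add: compact_imp_closed)
      show "finite {i \<in> {l. l mod 2 = q} \<times> UNIV. (case i of (l, u) \<Rightarrow> P l b u) \<inter> ball 0 R \<noteq> {}}" for R
        by (rule finite_subset[OF _ Efin[of b R]]) (use PV VE in blast)
    qed
    show "closed (- O' q b)" unfolding O'_def using V by (intro closed_Compl open_UN) auto
    show "S q b \<inter> - O' q b = {}" unfolding S_def O'_def using PV by blast
  qed
  have "{(x, y). x \<in> X \<and> y \<in> f x} \<subseteq>
      (\<Union>(q, b)\<in>{..<2} \<times> UNIV. S q b \<times> - O' q b \<union> (\<Gamma> q b lex1 \<union> \<Gamma> q b lex2))"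
  proof clarify
    fix x y assume x: "x \<in> X" and y: "y \<in> f x"
    define l where "l = (LEAST l. norm x \<le> r (Suc l))"
    obtain m :: nat where "norm x < real m" using reals_Archimedean2 by blast
    then have "norm x \<le> r (Suc m)" using rl[of m] rS[of m] by linarith
    then have l1: "norm x \<le> r (Suc l)" unfolding l_def by (rule LeastI)
    have l2: "r l \<le> norm x"
    proof (cases l)
      case 0 then show ?thesis by (simp add: r0)
    next
      case (Suc l')
      then have "\<not> norm x \<le> r (Suc l')" 
        using not_less_Least[of l' "\<lambda>l. norm x \<le> r (Suc l)"] unfolding l_def by linarith
      then show ?thesis using Suc by simp
    qed
    have "x \<in> K l" using x l1 l2 by (simp add: K_def)
    then obtain b u where xP: "x \<in> P l b u" using KP by blast
    then have xE: "x \<in> E l b u" using PV VE by blast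
    define q where "q = l mod 2"
    have qb: "(q, b) \<in> {..<2} \<times> UNIV" by (simp add: q_def)
    have xS: "x \<in> S q b" using xP by (auto simp: S_def q_def)
    have "(x, y) \<in> S q b \<times> - O' q b \<union> (\<Gamma> q b lex1 \<union> \<Gamma> q b lex2)"
    proof (cases "y \<in> O' q b")
      case False then show ?thesis using xS by blast
    next
      case True
      then obtain m v where m: "m mod 2 = q" and "y \<in> V m b v" by (auto simp: O'_def)
      then have yE: "y \<in> E m b v" using VE by blast
      have "norm x \<le> r (Suc l) + 1" using l1 by simp
      \<comment> \<open>As \<open>y\<close> also has norm above \<open>r m - 1/2\<close>, this
        excludes \<open>m\<close> beyond \<open>Suc l\<close>; parity excludes \<open>Suc l\<close>
        itself.\<close>
      then have "norm y < r (Suc (Suc l)) - 1" using rf[OF x, of "Suc l"] y by fastforce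
      moreover have "r m - 1/2 < norm y" using yE EN by (auto simp: N_def)
      ultimately have "\<not> Suc (Suc l) \<le> m" using rmono[of "Suc (Suc l)" m] by linarith
      moreover have "m \<noteq> Suc l" using m unfolding q_def by presburger
      ultimately have ml: "m \<le> l" by linarith
      have "((m, v), (l, u)) \<in> lex1 \<or> ((m, v), (l, u)) \<in> lex2"
      proof (cases "m = l")
        case False then show ?thesis using ml by (simp add: lex1_def)
      next
        case True
        have "v \<noteq> u" using Ef[of x l b u] x xE y yE True by blast
        \<comment> \<open>With this bound the truncated subtraction in \<open>lex2\<close> is
          strictly decreasing from \<open>u\<close> to \<open>v\<close> whenever
          \<open>u < v\<close>.\<close>
        moreover have "v < p l" using Ep[of l b v] yE True by blast
        ultimately show ?thesis using True by (auto simp: lex1_def lex2_def)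
      qed
      moreover have "x \<in> X \<inter> D q b (l, u)" "y \<in> f x \<inter> D q b (m, v)"
        using x xE y yE m by (simp_all add: D_def q_def)
      ultimately show ?thesis unfolding \<Gamma>_def by blast
    qed
    then show "(x, y) \<in> (\<Union>(q, b)\<in>{..<2} \<times> UNIV. S q b \<times> - O' q b \<union> (\<Gamma> q b lex1 \<union> \<Gamma> q b lex2))"
      using qb by blast
  qed
  moreover have "finitely_separated
      (\<Union>(q, b)\<in>{..<2} \<times> UNIV. S q b \<times> - O' q b \<union> (\<Gamma> q b lex1 \<union> \<Gamma> q b lex2))"
  proof (rule finitely_separated_UN)
    have "wf lex1" "wf lex2" by (auto simp: lex1_def lex2_def)
    then show "finitely_separated (case i of (q, b) \<Rightarrow> S q b \<times> - O' q b \<union> (\<Gamma> q b lex1 \<union> \<Gamma> q b lex2))" for i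
      using SO \<Gamma> by (cases i) (auto intro!: finitely_separated_Un)
  qed simp
  ultimately show ?thesis by (rule finitely_separated_subset[rotated])
qed

section \<open>Passage to the Cech-Stone compactification\<close>

lemma cech_stone_ext_correct:
  fixes X :: "'a::metric_space set"
  assumes f: "continuous_map (top_of_set X) (exp_space n euclidean) f" and X: "closed X"
  shows "is_cech_stone_ext n euclidean X f (cech_stone_ext n euclidean X f)"
  unfolding cech_stone_ext_def
  using theI'[OF cech_stone_ext_ex1[OF metrizable_imp_normal_space[OF metrizable_space_euclidean] _ f]] X
  by simp

text \<open>If \<open>p\<close> belonged to its own value, every neighbourhood \<open>N\<close> of
  \<open>p\<close> would meet the values at all points near \<open>p\<close>. By density some
  \<open>x\<close> in \<open>X\<close> and some \<open>y\<close> in \<open>f x\<close> would both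
  have images in \<open>N\<close>, contradicting the gap once \<open>N\<close> is small in the
  coordinates \<open>C\<close>.\<close>

lemma fixed_point_free_cech_stone_ext:
  fixes X :: "'a::metric_space set"
  assumes f: "continuous_map (top_of_set X) (exp_space n euclidean) f" and X: "closed X"
    and sep: "finitely_separated {(x, y). x \<in> X \<and> y \<in> f x}"
  shows "fixed_point_free (topspace (cech_stone_sub euclidean X)) (cech_stone_ext n euclidean X f)"
  unfolding fixed_point_free_def
proof (intro ballI notI)
  let ?e = "cech_stone_map (euclidean :: 'a topology)" and ?B = "cech_stone (euclidean :: 'a topology)"
    and ?S = "cech_stone_sub euclidean X"
  define g where "g = cech_stone_ext n euclidean X f"
  have "is_cech_stone_ext n euclidean X f g"
    unfolding g_def using f X by (rule cech_stone_ext_correct)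
  then have g: "continuous_map ?S (exp_space n ?B) g" "\<And>x. x \<in> X \<Longrightarrow> g (?e x) = ?e ` f x"
    by (auto simp: is_cech_stone_ext_def)
  obtain C \<epsilon> where C: "finite C" "0 < \<epsilon>"
    "\<And>c. c \<in> C \<Longrightarrow> continuous_on UNIV c" "\<And>c x. c \<in> C \<Longrightarrow> c x \<in> {0..1::real}"
    "\<And>x y. (x, y) \<in> {(x, y). x \<in> X \<and> y \<in> f x} \<Longrightarrow> \<exists>c\<in>C. \<epsilon> \<le> \<bar>c x - c y\<bar>"
    using sep by (rule finitely_separatedE) blast
  have CU: "c \<in> unit_maps euclidean" if "c \<in> C" for c
    using C(3,4)[OF that] by (auto simp: unit_maps_def continuous_map_in_subtopology)
  fix p assume p: "p \<in> topspace ?S" "p \<in> cech_stone_ext n euclidean X f p"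
  define N where "N = {q \<in> topspace ?B. \<forall>c\<in>C. \<bar>q c - p c\<bar> < \<epsilon> / 2}"
  have "openin ?B N"
  proof -
    have "openin ?B {q \<in> topspace ?B. q c \<in> ball (p c) (\<epsilon> / 2)}" if "c \<in> C" for c
    proof (rule openin_continuous_map_preimage[of _ euclideanreal])
      show "continuous_map ?B euclideanreal (\<lambda>q. q c)"
        using continuous_map_cech_stone_coord[OF CU[OF that]] by (simp add: continuous_map_in_subtopology)
    qed auto
    \<comment> \<open>The extra member \<open>topspace ?B\<close> covers the case of empty
      \<open>C\<close>.\<close>
    then have "openin ?B (\<Inter> (insert (topspace ?B) ((\<lambda>c. {q \<in> topspace ?B. q c \<in> ball (p c) (\<epsilon> / 2)}) ` C)))"
      using C(1) by (intro openin_Inter) auto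
    also have "(\<Inter> (insert (topspace ?B) ((\<lambda>c. {q \<in> topspace ?B. q c \<in> ball (p c) (\<epsilon> / 2)}) ` C))) = N"
      by (auto simp: N_def dist_real_def abs_minus_commute)
    finally show ?thesis .
  qed
  have "p \<in> topspace ?B" using p(1) by (simp add: cech_stone_sub_def)
  then have pN: "p \<in> N" using C(2) by (simp add: N_def)
  define H where "H = {q \<in> topspace ?S. g q \<in> {A \<in> topspace (exp_space n ?B). A \<inter> N \<noteq> {}}}"
  have "openin ?S H"
    unfolding H_def
    by (rule openin_continuous_map_preimage[OF g(1) openin_exp_space_hit[OF \<open>openin ?B N\<close>]])
  then obtain M where M: "openin ?B M" "H = M \<inter> topspace ?S"
    unfolding topspace_cech_stone_sub by (auto simp: cech_stone_sub_def openin_subtopology)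
  have "g p \<in> topspace (exp_space n ?B)"
    using continuous_map_image_subset_topspace[OF g(1)] p(1) by blast
  then have "p \<in> H" using p pN by (auto simp: H_def g_def)
  then have "p \<in> M" using M(2) by blast
  then have "p \<in> N \<inter> M" "openin ?B (N \<inter> M)" using pN M(1) \<open>openin ?B N\<close> by auto
  moreover have "p \<in> ?B closure_of (?e ` X)"
    using p(1) by (simp add: topspace_cech_stone_sub)
  ultimately obtain x where x: "x \<in> X" "?e x \<in> N" "?e x \<in> M"
    unfolding in_closure_of by blast
  moreover have "?e x \<in> topspace ?S" using cech_stone_map_in_sub[of X euclidean x] x(1) by simp
  ultimately have "?e x \<in> H" using M(2) by blast
  then have "g (?e x) \<inter> N \<noteq> {}" by (simp add: H_def)
  then obtain y where y: "y \<in> f x" "?e y \<in> N" using g(2)[OF x(1)] by auto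
  then obtain c where c: "c \<in> C" "\<epsilon> \<le> \<bar>c x - c y\<bar>" using C(5) x(1) by blast
  have "?e z c = c z" for z using CU[OF c(1)] by (simp add: cech_stone_map_def)
  then have "\<bar>c x - p c\<bar> < \<epsilon> / 2" "\<bar>c y - p c\<bar> < \<epsilon> / 2"
    using x(2) y(2) c(1) by (auto simp: N_def)
  then show False using c(2) by linarith
qed

theorem theorem2p10:
  fixes n :: nat and X :: "(real ^ 'k) set" and f :: "real ^ 'k \<Rightarrow> (real ^ 'k) set"
  assumes "n \<ge> 1"
    and "closed X"
    and "continuous_map (top_of_set X) (exp_space n euclidean) f"
  shows "fixed_point_free X f \<longleftrightarrow>
    fixed_point_free (topspace (cech_stone_sub euclidean X)) (cech_stone_ext n euclidean X f)"
proof
  assume "fixed_point_free X f"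
  then have "finitely_separated {(x, y). x \<in> X \<and> y \<in> f x}"
    by (intro graph_finitely_separated[OF assms(3,2)]) (simp add: fixed_point_free_def)
  then show "fixed_point_free (topspace (cech_stone_sub euclidean X)) (cech_stone_ext n euclidean X f)"
    by (rule fixed_point_free_cech_stone_ext[OF assms(3,2)])
next
  assume free: "fixed_point_free (topspace (cech_stone_sub euclidean X)) (cech_stone_ext n euclidean X f)"
  have ext: "cech_stone_ext n euclidean X f (cech_stone_map euclidean x) = cech_stone_map euclidean ` f x"
    if "x \<in> X" for x
    using cech_stone_ext_correct[OF assms(3,2)] that by (simp add: is_cech_stone_ext_def)
  show "fixed_point_free X f"
    unfolding fixed_point_free_def
  proof (intro ballI notI)
    \<comment> \<open>A fixed point of \<open>f\<close> maps to a fixed point of the extension,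
      which takes the image of \<open>f x\<close> as its value there.\<close>
    fix x assume x: "x \<in> X" "x \<in> f x"
    have "cech_stone_map euclidean x \<in> topspace (cech_stone_sub euclidean X)"
      by (rule cech_stone_map_in_sub) (use x in auto)
    with free ext[OF x(1)] x(2) show False by (auto simp: fixed_point_free_def)
  qed
qed

end
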